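(* Let $\mathcal A$ and $\mathfrak A$ be Banach algebras such that $\mathcal A$ is a Banach $\mathfrak A$-bimodule with compatible actions. Let $\mathcal A$ be unital and let $n\in\mathbb N\cup\{0\}$. Then $\mathcal A\rtimes\mathfrak A$ is $n$-weakly amenable if and only if $\mathcal A$ and $\mathfrak A$ are $n$-weakly amenable.
   Context: The actions of $\mathfrak A$ on $\mathcal A$ are compatible if for all $a,b\in\mathcal A$ and $\beta\in\mathfrak A$: $\beta\cdot(ab)=(\beta\cdot a)b$, $(ab)\cdot\beta=a(b\cdot\beta)$, $a(\beta\cdot b)=(a\cdot\beta)b$. The amalgamated duplication $\mathcal A\rtimes\mathfrak A$ is $\mathcal A\times\mathfrak A$ with product $(a,\beta)(b,\gamma)=(ab+a\cdot\gamma+\beta\cdot b,\ \beta\gamma)$ and norm $\|(a,\beta)\|=\|a\|+\|\beta\|$. $\mathcal Y^{(k)}$ is the $k$-th dual of a Banach space $\mathcal Y$, with $\mathcal Y^{(0)}=\mathcal Y$. If $\mathcal X$ is a Banach $\mathcal C$-bimodule, its dual is one via $\langle f\cdot c,x\rangle=\langle f,c\cdot x\rangle$, $\langle c\cdot f,x\rangle=\langle f,x\cdot c\rangle$; iterating, $\mathcal C^{(k)}$ is a Banach $\mathcal C$-bimodule. A derivation $D:\mathcal C\to\mathcal X$ is a continuous linear map with $D(c_1c_2)=D(c_1)\cdot c_2+c_1\cdot D(c_2)$; it is inner if $D(c)=c\cdot x-x\cdot c$ for some $x\in\mathcal X$. $\mathcal C$ is $n$-weakly amenable ($n\ge0$)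 if every derivation $\mathcal C\to\mathcal C^{(n)}$ is inner. *)

theory Defs
  imports "HOL-Analysis.Analysis" "HOL-Algebra.Module"
begin

section \<open>Complex normed spaces, Banach algebras and Banach bimodules\<close>

text \<open>
  All spaces are complex and are given by explicit carriers, since the iterated duals of a space
  and the amalgamated duplication of two algebras are not canonically attached to types.
  As in \<^locale>\<open>Module.module\<close>, a vector space ignores the ring fields \<open>mult\<close> and \<open>one\<close> of its
  record; a Banach algebra uses \<open>mult\<close>, and the field \<open>one\<close> is never used (an algebra need not have
  a unit, see \<open>unital\<close> below).
\<close>

definition complex_field :: "complex ring"
  where "complex_field = \<lparr>carrier = UNIV, mult = (*), one = 1, zero = 0, add = (+)\<rparr>"

record 'x normed_space = "(complex, 'x) module" +
  nrm :: "'x \<Rightarrow> real"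

record ('c, 'x) bimodule = "'x normed_space" +
  lact :: "'c \<Rightarrow> 'x \<Rightarrow> 'x"
  ract :: "'x \<Rightarrow> 'c \<Rightarrow> 'x"

locale complex_normed_space = Module.module complex_field X
  for X :: "('x, 'm) normed_space_scheme" (structure) +
  assumes nrm_nonneg: "x \<in> carrier X \<Longrightarrow> 0 \<le> nrm X x"
    and nrm_eq_0_iff: "x \<in> carrier X \<Longrightarrow> nrm X x = 0 \<longleftrightarrow> x = \<zero>"
    and nrm_smult: "x \<in> carrier X \<Longrightarrow> nrm X (a \<odot> x) = cmod a * nrm X x"
    and nrm_triangle:
      "\<lbrakk>x \<in> carrier X; y \<in> carrier X\<rbrakk> \<Longrightarrow> nrm X (x \<oplus> y) \<le> nrm X x + nrm X y"

text \<open>\<^locale>\<open>Metric_space\<close> wants a distance that is symmetric and nonnegative also off the carrier.\<close>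

definition nrm_dist :: "('x, 'm) normed_space_scheme \<Rightarrow> 'x \<Rightarrow> 'x \<Rightarrow> real"
  where "nrm_dist X x y =
    (if x \<in> carrier X \<and> y \<in> carrier X then nrm X (x \<ominus>\<^bsub>X\<^esub> y) else 0)"

lemma complex_field_simps [simp]:
  "carrier complex_field = UNIV"
  "a \<oplus>\<^bsub>complex_field\<^esub> b = a + b"
  "a \<otimes>\<^bsub>complex_field\<^esub> b = a * b"
  "\<one>\<^bsub>complex_field\<^esub> = 1"
  "\<zero>\<^bsub>complex_field\<^esub> = 0"
  by (simp_all add: complex_field_def)

lemma cring_complex_field: "cring complex_field"
proof (rule cringI)
  show "abelian_group complex_field"
  proof (rule abelian_groupI)
    fix a :: complex
    show "\<exists>b\<in>carrier complex_field. b \<oplus>\<^bsub>complex_field\<^esub> a = \<zero>\<^bsub>complex_field\<^esub>"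
      by (rule bexI[of _ "- a"]) simp_all
  qed simp_all
  show "comm_monoid complex_field"
    by (rule comm_monoidI) simp_all
qed (simp add: algebra_simps)

lemma complex_field_uminus [simp]: "\<ominus>\<^bsub>complex_field\<^esub> a = - a"
proof -
  interpret K: cring complex_field
    by (rule cring_complex_field)
  have "\<ominus>\<^bsub>complex_field\<^esub> a = - a"
    by (rule K.minus_equality) simp_all
  then show ?thesis .
qed

context complex_normed_space
begin

lemma one_smult: "x \<in> carrier X \<Longrightarrow> 1 \<odot> x = x"
  using smult_one[of x] by simp

lemma smult_minus_one: "x \<in> carrier X \<Longrightarrow> (- 1) \<odot> x = \<ominus> x"
  using smult_l_minus[of 1 x] by (simp add: one_smult)

lemma nrm_minus: "x \<in> carrier X \<Longrightarrow> nrm X (\<ominus> x) = nrm X x"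
  using nrm_smult[of x "- 1"] by (simp add: smult_minus_one)

lemma Metric_space_nrm_dist: "Metric_space (carrier X) (nrm_dist X)"
proof
  fix x y z
  show "0 \<le> nrm_dist X x y"
    by (simp add: nrm_dist_def nrm_nonneg)
  show "nrm_dist X x y = nrm_dist X y x"
  proof (cases "x \<in> carrier X \<and> y \<in> carrier X")
    case True
    then have "\<ominus> (x \<ominus> y) = y \<ominus> x"
      by (simp add: a_minus_def minus_add a_comm)
    then show ?thesis
      using True nrm_minus[of "x \<ominus> y"] by (simp add: nrm_dist_def)
  qed (auto simp: nrm_dist_def)
  show "nrm_dist X x y = 0 \<longleftrightarrow> x = y" if "x \<in> carrier X" "y \<in> carrier X"
  proof -
    have "x = y" if "x \<ominus> y = \<zero>"
    proof -
      have "x = (x \<ominus> y) \<oplus> y"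
        using \<open>x \<in> carrier X\<close> \<open>y \<in> carrier X\<close> by (simp add: a_minus_def a_assoc l_neg)
      then show ?thesis
        using \<open>y \<in> carrier X\<close> unfolding that by simp
    qed
    then show ?thesis
      using that by (auto simp: nrm_dist_def nrm_eq_0_iff a_minus_def r_neg)
  qed
  show "nrm_dist X x z \<le> nrm_dist X x y + nrm_dist X y z"
    if "x \<in> carrier X" "y \<in> carrier X" "z \<in> carrier X"
  proof -
    have "x \<ominus> z = (x \<ominus> y) \<oplus> (y \<ominus> z)"
      using that by (simp add: a_minus_def a_assoc r_neg1)
    then show ?thesis
      using that nrm_triangle[of "x \<ominus> y" "y \<ominus> z"] by (simp add: nrm_dist_def)
  qed
qed

sublocale Metric_space "carrier X" "nrm_dist X"
  by (rule Metric_space_nrm_dist)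

end

locale complex_banach_space = complex_normed_space +
  assumes complete: "mcomplete"

locale banach_algebra = complex_banach_space C
  for C :: "('c, 'm) normed_space_scheme" (structure) +
  assumes mult_closed: "\<lbrakk>a \<in> carrier C; b \<in> carrier C\<rbrakk> \<Longrightarrow> a \<otimes> b \<in> carrier C"
    and mult_assoc: "\<lbrakk>a \<in> carrier C; b \<in> carrier C; c \<in> carrier C\<rbrakk>
      \<Longrightarrow> (a \<otimes> b) \<otimes> c = a \<otimes> (b \<otimes> c)"
    and mult_add_left: "\<lbrakk>a \<in> carrier C; b \<in> carrier C; c \<in> carrier C\<rbrakk>
      \<Longrightarrow> (a \<oplus> b) \<otimes> c = a \<otimes> c \<oplus> b \<otimes> c"
    and mult_add_right: "\<lbrakk>a \<in> carrier C; b \<in> carrier C; c \<in> carrier C\<rbrakk>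
      \<Longrightarrow> a \<otimes> (b \<oplus> c) = a \<otimes> b \<oplus> a \<otimes> c"
    and mult_smult_left: "\<lbrakk>a \<in> carrier C; b \<in> carrier C\<rbrakk> \<Longrightarrow> (k \<odot> a) \<otimes> b = k \<odot> (a \<otimes> b)"
    and mult_smult_right: "\<lbrakk>a \<in> carrier C; b \<in> carrier C\<rbrakk> \<Longrightarrow> a \<otimes> (k \<odot> b) = k \<odot> (a \<otimes> b)"
    and nrm_mult: "\<lbrakk>a \<in> carrier C; b \<in> carrier C\<rbrakk> \<Longrightarrow> nrm C (a \<otimes> b) \<le> nrm C a * nrm C b"

definition unital :: "('c, 'm) normed_space_scheme \<Rightarrow> bool"
  where "unital C \<longleftrightarrow>
    (\<exists>e\<in>carrier C. \<forall>a\<in>carrier C. e \<otimes>\<^bsub>C\<^esub> a = a \<and> a \<otimes>\<^bsub>C\<^esub> e = a)"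

text \<open>
  The module actions are only required to be jointly continuous, that is,
  bounded by \<open>K * \<parallel>c\<parallel> * \<parallel>x\<parallel>\<close> for some constant \<open>K\<close>; contractive actions are the case \<open>K = 1\<close>.
  The locales for bimodules put no requirements on \<open>C\<close>; that it is a Banach algebra is stated
  separately.
\<close>

locale normed_bimodule = complex_normed_space X
  for C :: "('c, 'm) normed_space_scheme" and X :: "('c, 'x, 'n) bimodule_scheme" (structure) +
  assumes lact_closed: "\<lbrakk>c \<in> carrier C; x \<in> carrier X\<rbrakk> \<Longrightarrow> lact X c x \<in> carrier X"
    and ract_closed: "\<lbrakk>c \<in> carrier C; x \<in> carrier X\<rbrakk> \<Longrightarrow> ract X x c \<in> carrier X"
    and lact_add: "\<lbrakk>c \<in> carrier C; x \<in> carrier X; y \<in> carrier X\<rbrakk>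
      \<Longrightarrow> lact X c (x \<oplus> y) = lact X c x \<oplus> lact X c y"
    and ract_add: "\<lbrakk>c \<in> carrier C; x \<in> carrier X; y \<in> carrier X\<rbrakk>
      \<Longrightarrow> ract X (x \<oplus> y) c = ract X x c \<oplus> ract X y c"
    and lact_smult: "\<lbrakk>c \<in> carrier C; x \<in> carrier X\<rbrakk> \<Longrightarrow> lact X c (k \<odot> x) = k \<odot> lact X c x"
    and ract_smult: "\<lbrakk>c \<in> carrier C; x \<in> carrier X\<rbrakk> \<Longrightarrow> ract X (k \<odot> x) c = k \<odot> ract X x c"
    and add_lact: "\<lbrakk>c \<in> carrier C; d \<in> carrier C; x \<in> carrier X\<rbrakk>
      \<Longrightarrow> lact X (c \<oplus>\<^bsub>C\<^esub> d) x = lact X c x \<oplus> lact X d x"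
    and add_ract: "\<lbrakk>c \<in> carrier C; d \<in> carrier C; x \<in> carrier X\<rbrakk>
      \<Longrightarrow> ract X x (c \<oplus>\<^bsub>C\<^esub> d) = ract X x c \<oplus> ract X x d"
    and smult_lact: "\<lbrakk>c \<in> carrier C; x \<in> carrier X\<rbrakk>
      \<Longrightarrow> lact X (k \<odot>\<^bsub>C\<^esub> c) x = k \<odot> lact X c x"
    and smult_ract: "\<lbrakk>c \<in> carrier C; x \<in> carrier X\<rbrakk>
      \<Longrightarrow> ract X x (k \<odot>\<^bsub>C\<^esub> c) = k \<odot> ract X x c"
    and lact_mult: "\<lbrakk>c \<in> carrier C; d \<in> carrier C; x \<in> carrier X\<rbrakk>
      \<Longrightarrow> lact X (c \<otimes>\<^bsub>C\<^esub> d) x = lact X c (lact X d x)"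
    and ract_mult: "\<lbrakk>c \<in> carrier C; d \<in> carrier C; x \<in> carrier X\<rbrakk>
      \<Longrightarrow> ract X x (c \<otimes>\<^bsub>C\<^esub> d) = ract X (ract X x c) d"
    and lact_ract: "\<lbrakk>c \<in> carrier C; d \<in> carrier C; x \<in> carrier X\<rbrakk>
      \<Longrightarrow> ract X (lact X c x) d = lact X c (ract X x d)"
    and lact_bounded: "\<exists>K. \<forall>c\<in>carrier C. \<forall>x\<in>carrier X. nrm X (lact X c x) \<le> K * nrm C c * nrm X x"
    and ract_bounded: "\<exists>K. \<forall>c\<in>carrier C. \<forall>x\<in>carrier X. nrm X (ract X x c) \<le> K * nrm C c * nrm X x"

locale banach_bimodule = normed_bimodule C X + complex_banach_space X
  for C :: "('c, 'm) normed_space_scheme" and X :: "('c, 'x, 'n) bimodule_scheme" (structure)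

definition with_actions ::
  "('x, 'm) normed_space_scheme \<Rightarrow> ('c \<Rightarrow> 'x \<Rightarrow> 'x) \<Rightarrow> ('x \<Rightarrow> 'c \<Rightarrow> 'x) \<Rightarrow> ('c, 'x) bimodule"
  where "with_actions X l r =
    \<lparr>carrier = carrier X, mult = mult X, one = one X, zero = zero X, add = add X,
     smult = smult X, nrm = nrm X, lact = l, ract = r\<rparr>"

definition self_bimodule :: "('c, 'm) normed_space_scheme \<Rightarrow> ('c, 'c) bimodule"
  where "self_bimodule C = with_actions C (mult C) (mult C)"


section \<open>Compatible actions and the amalgamated duplication\<close>

definition compatible_actions ::
  "('a, 'm) normed_space_scheme \<Rightarrow> ('b, 'n) normed_space_scheme \<Rightarrow>
   ('b \<Rightarrow> 'a \<Rightarrow> 'a) \<Rightarrow> ('a \<Rightarrow> 'b \<Rightarrow> 'a) \<Rightarrow> bool"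
  where "compatible_actions A B l r \<longleftrightarrow>
    (\<forall>a\<in>carrier A. \<forall>b\<in>carrier A. \<forall>\<beta>\<in>carrier B.
       l \<beta> (a \<otimes>\<^bsub>A\<^esub> b) = l \<beta> a \<otimes>\<^bsub>A\<^esub> b \<and>
       r (a \<otimes>\<^bsub>A\<^esub> b) \<beta> = a \<otimes>\<^bsub>A\<^esub> r b \<beta> \<and>
       a \<otimes>\<^bsub>A\<^esub> l \<beta> b = r a \<beta> \<otimes>\<^bsub>A\<^esub> b)"

definition amalgamated_duplication ::
  "('a, 'm) normed_space_scheme \<Rightarrow> ('b, 'n) normed_space_scheme \<Rightarrow>
   ('b \<Rightarrow> 'a \<Rightarrow> 'a) \<Rightarrow> ('a \<Rightarrow> 'b \<Rightarrow> 'a) \<Rightarrow> ('a \<times> 'b) normed_space"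
  where "amalgamated_duplication A B l r =
    \<lparr>carrier = carrier A \<times> carrier B,
     mult = (\<lambda>(a, \<beta>) (b, \<gamma>). (a \<otimes>\<^bsub>A\<^esub> b \<oplus>\<^bsub>A\<^esub> r a \<gamma> \<oplus>\<^bsub>A\<^esub> l \<beta> b, \<beta> \<otimes>\<^bsub>B\<^esub> \<gamma>)),
     one = undefined,
     zero = (\<zero>\<^bsub>A\<^esub>, \<zero>\<^bsub>B\<^esub>),
     add = (\<lambda>(a, \<beta>) (b, \<gamma>). (a \<oplus>\<^bsub>A\<^esub> b, \<beta> \<oplus>\<^bsub>B\<^esub> \<gamma>)),
     smult = (\<lambda>k (a, \<beta>). (k \<odot>\<^bsub>A\<^esub> a, k \<odot>\<^bsub>B\<^esub> \<beta>)),
     nrm = (\<lambda>(a, \<beta>). nrm A a + nrm B \<beta>)\<rparr>"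


section \<open>Duals\<close>

definition bounded_functional :: "('x, 'm) normed_space_scheme \<Rightarrow> ('x \<Rightarrow> complex) \<Rightarrow> bool"
  where "bounded_functional X f \<longleftrightarrow>
    (\<forall>x\<in>carrier X. \<forall>y\<in>carrier X. f (x \<oplus>\<^bsub>X\<^esub> y) = f x + f y) \<and>
    (\<forall>k. \<forall>x\<in>carrier X. f (k \<odot>\<^bsub>X\<^esub> x) = k * f x) \<and>
    (\<exists>K. \<forall>x\<in>carrier X. cmod (f x) \<le> K * nrm X x)"

definition dual_bimodule :: "('c, 'x, 'n) bimodule_scheme \<Rightarrow> ('c, 'x \<Rightarrow> complex) bimodule"
  where "dual_bimodule X =
    \<lparr>carrier = {f \<in> extensional (carrier X). bounded_functional X f},
     mult = undefined,
     one = undefined,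
     zero = (\<lambda>x\<in>carrier X. 0),
     add = (\<lambda>f g. \<lambda>x\<in>carrier X. f x + g x),
     smult = (\<lambda>k f. \<lambda>x\<in>carrier X. k * f x),
     nrm = (\<lambda>f. SUP x\<in>{x \<in> carrier X. nrm X x \<le> 1}. cmod (f x)),
     lact = (\<lambda>c f. \<lambda>x\<in>carrier X. f (ract X x c)),
     ract = (\<lambda>f c. \<lambda>x\<in>carrier X. f (lact X c x))\<rparr>"

definition isometric_bimodule_iso ::
  "('c, 'm) normed_space_scheme \<Rightarrow> ('c, 'x, 'n) bimodule_scheme \<Rightarrow> ('c, 'y, 'k) bimodule_scheme \<Rightarrow>
   ('x \<Rightarrow> 'y) \<Rightarrow> bool"
  where "isometric_bimodule_iso C X Y \<phi> \<longleftrightarrow>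
    bij_betw \<phi> (carrier X) (carrier Y) \<and>
    \<phi> \<zero>\<^bsub>X\<^esub> = \<zero>\<^bsub>Y\<^esub> \<and>
    (\<forall>x\<in>carrier X. \<forall>y\<in>carrier X. \<phi> (x \<oplus>\<^bsub>X\<^esub> y) = \<phi> x \<oplus>\<^bsub>Y\<^esub> \<phi> y) \<and>
    (\<forall>k. \<forall>x\<in>carrier X. \<phi> (k \<odot>\<^bsub>X\<^esub> x) = k \<odot>\<^bsub>Y\<^esub> \<phi> x) \<and>
    (\<forall>x\<in>carrier X. nrm Y (\<phi> x) = nrm X x) \<and>
    (\<forall>c\<in>carrier C. \<forall>x\<in>carrier X.
       \<phi> (lact X c x) = lact Y c (\<phi> x) \<and> \<phi> (ract X x c) = ract Y (\<phi> x) c)"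

definition isometric_bimodules ::
  "('c, 'm) normed_space_scheme \<Rightarrow> ('c, 'x, 'n) bimodule_scheme \<Rightarrow> ('c, 'y, 'k) bimodule_scheme \<Rightarrow> bool"
  where "isometric_bimodules C X Y \<longleftrightarrow> (\<exists>\<phi>. isometric_bimodule_iso C X Y \<phi>)"

text \<open>
  The literal iterates of \<^const>\<open>dual_bimodule\<close> live in the pairwise different types \<open>'c\<close>,
  \<open>'c \<Rightarrow> complex\<close>, \<open>('c \<Rightarrow> complex) \<Rightarrow> complex\<close> and so on, so for variable \<open>n\<close> they are not terms
  of a single type.  A dual tower of height \<open>n\<close> is a copy of \<open>C\<close>, \<open>C\<^sup>(\<^sup>1\<^sup>)\<close>, ..., \<open>C\<^sup>(\<^sup>n\<^sup>)\<close>, up to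
  isometric bimodule isomorphism, within one type \<open>'u\<close>: the bimodule at level \<open>Suc k\<close> is (a copy
  of) the dual of the bimodule at level \<open>k\<close>.  Lemmas \<open>dual_tower_0\<close> and \<open>dual_tower_Suc_ex\<close> below
  show that every height is realised in a suitable type, and \<open>dual_tower_unique\<close> shows that
  the levels of a tower are determined by \<open>C\<close> up to isometric bimodule isomorphism.
\<close>

definition dual_tower ::
  "('c, 'm) normed_space_scheme \<Rightarrow> nat \<Rightarrow> (nat \<Rightarrow> ('c, 'u) bimodule) \<Rightarrow> bool"
  where "dual_tower C n T \<longleftrightarrow>
    isometric_bimodules C (self_bimodule C) (T 0) \<and>
    (\<forall>k<n. isometric_bimodules C (dual_bimodule (T k)) (T (Suc k)))"


section \<open>Derivations and weak amenability\<close>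

definition derivation ::
  "('c, 'm) normed_space_scheme \<Rightarrow> ('c, 'x, 'n) bimodule_scheme \<Rightarrow> ('c \<Rightarrow> 'x) \<Rightarrow> bool"
  where "derivation C X D \<longleftrightarrow>
    D \<in> carrier C \<rightarrow> carrier X \<and>
    (\<forall>c\<in>carrier C. \<forall>d\<in>carrier C. D (c \<oplus>\<^bsub>C\<^esub> d) = D c \<oplus>\<^bsub>X\<^esub> D d) \<and>
    (\<forall>k. \<forall>c\<in>carrier C. D (k \<odot>\<^bsub>C\<^esub> c) = k \<odot>\<^bsub>X\<^esub> D c) \<and>
    (\<exists>K. \<forall>c\<in>carrier C. nrm X (D c) \<le> K * nrm C c) \<and>
    (\<forall>c\<in>carrier C. \<forall>d\<in>carrier C.
       D (c \<otimes>\<^bsub>C\<^esub> d) = ract X (D c) d \<oplus>\<^bsub>X\<^esub> lact X c (D d))"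

definition inner_derivation ::
  "('c, 'm) normed_space_scheme \<Rightarrow> ('c, 'x, 'n) bimodule_scheme \<Rightarrow> ('c \<Rightarrow> 'x) \<Rightarrow> bool"
  where "inner_derivation C X D \<longleftrightarrow>
    (\<exists>x\<in>carrier X. \<forall>c\<in>carrier C. D c = lact X c x \<ominus>\<^bsub>X\<^esub> ract X x c)"

text \<open>Here \<open>T\<close> is meant to be a dual tower of \<open>C\<close> of height at least \<open>n\<close>, so \<open>T n\<close> is \<open>C\<^sup>(\<^sup>n\<^sup>)\<close>.\<close>

definition n_weakly_amenable ::
  "nat \<Rightarrow> ('c, 'm) normed_space_scheme \<Rightarrow> (nat \<Rightarrow> ('c, 'u) bimodule) \<Rightarrow> bool"
  where "n_weakly_amenable n C T \<longleftrightarrow>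
    (\<forall>D. derivation C (T n) D \<longrightarrow> inner_derivation C (T n) D)"

section \<open>Dual towers exist and are essentially unique\<close>

lemma isometric_bimodule_isoD:
  assumes "isometric_bimodule_iso C X Y \<phi>"
  shows "bij_betw \<phi> (carrier X) (carrier Y)"
    and "x \<in> carrier X \<Longrightarrow> \<phi> x \<in> carrier Y"
    and "\<phi> \<zero>\<^bsub>X\<^esub> = \<zero>\<^bsub>Y\<^esub>"
    and "\<lbrakk>x \<in> carrier X; y \<in> carrier X\<rbrakk> \<Longrightarrow> \<phi> (x \<oplus>\<^bsub>X\<^esub> y) = \<phi> x \<oplus>\<^bsub>Y\<^esub> \<phi> y"
    and "x \<in> carrier X \<Longrightarrow> \<phi> (k \<odot>\<^bsub>X\<^esub> x) = k \<odot>\<^bsub>Y\<^esub> \<phi> x"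
    and "x \<in> carrier X \<Longrightarrow> nrm Y (\<phi> x) = nrm X x"
    and "\<lbrakk>c \<in> carrier C; x \<in> carrier X\<rbrakk> \<Longrightarrow> \<phi> (lact X c x) = lact Y c (\<phi> x)"
    and "\<lbrakk>c \<in> carrier C; x \<in> carrier X\<rbrakk> \<Longrightarrow> \<phi> (ract X x c) = ract Y (\<phi> x) c"
  using assms unfolding isometric_bimodule_iso_def bij_betw_def by auto

lemma self_bimodule_closed:
  assumes "normed_bimodule C (self_bimodule C)"
  shows "\<lbrakk>c \<in> carrier C; d \<in> carrier C\<rbrakk> \<Longrightarrow> c \<oplus>\<^bsub>C\<^esub> d \<in> carrier C"
    and "c \<in> carrier C \<Longrightarrow> k \<odot>\<^bsub>C\<^esub> c \<in> carrier C"
    and "\<lbrakk>c \<in> carrier C; d \<in> carrier C\<rbrakk> \<Longrightarrow> c \<otimes>\<^bsub>C\<^esub> d \<in> carrier C"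
proof -
  interpret S: normed_bimodule C "self_bimodule C" by (rule assms)
  show "\<lbrakk>c \<in> carrier C; d \<in> carrier C\<rbrakk> \<Longrightarrow> c \<oplus>\<^bsub>C\<^esub> d \<in> carrier C"
    using S.a_closed[of c d] by (simp add: self_bimodule_def with_actions_def)
  show "c \<in> carrier C \<Longrightarrow> k \<odot>\<^bsub>C\<^esub> c \<in> carrier C"
    using S.smult_closed[of k c] by (simp add: self_bimodule_def with_actions_def)
  show "\<lbrakk>c \<in> carrier C; d \<in> carrier C\<rbrakk> \<Longrightarrow> c \<otimes>\<^bsub>C\<^esub> d \<in> carrier C"
    using S.lact_closed[of c d] by (simp add: self_bimodule_def with_actions_def)
qed

lemma normed_bimodule_iso:
  fixes X :: "('c, 'x, 'n) bimodule_scheme" and Y :: "('c, 'y, 'k) bimodule_scheme"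
  assumes C: "normed_bimodule C (self_bimodule C)"
    and X: "normed_bimodule C X" and iso: "isometric_bimodule_iso C X Y \<phi>"
  shows "normed_bimodule C Y"
proof -
  note cC = self_bimodule_closed[OF C]
  interpret X: normed_bimodule C X by (rule X)
  note i = isometric_bimodule_isoD[OF iso]
  have ex: "\<exists>x\<in>carrier X. y = \<phi> x" if "y \<in> carrier Y" for y
    using that i(1) unfolding bij_betw_def by blast
  have z: "\<zero>\<^bsub>Y\<^esub> = \<phi> \<zero>\<^bsub>X\<^esub>" using i(3) by simp
  have a: "\<phi> x \<oplus>\<^bsub>Y\<^esub> \<phi> y = \<phi> (x \<oplus>\<^bsub>X\<^esub> y)" if "x \<in> carrier X" "y \<in> carrier X" for x y
    using i(4) that by simp
  have s: "k \<odot>\<^bsub>Y\<^esub> \<phi> x = \<phi> (k \<odot>\<^bsub>X\<^esub> x)" if "x \<in> carrier X" for k x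
    using i(5) that by simp
  have l: "lact Y c (\<phi> x) = \<phi> (lact X c x)" if "c \<in> carrier C" "x \<in> carrier X" for c x
    using i(7) that by simp
  have r: "ract Y (\<phi> x) c = \<phi> (ract X x c)" if "c \<in> carrier C" "x \<in> carrier X" for c x
    using i(8) that by simp
  have sc: "k \<odot>\<^bsub>X\<^esub> x \<in> carrier X" if "x \<in> carrier X" for k x
    using X.smult_closed[of k x] that by simp
  have inj: "\<phi> x = \<phi> y \<longleftrightarrow> x = y" if "x \<in> carrier X" "y \<in> carrier X" for x y
    using i(1) that unfolding bij_betw_def inj_on_def by blast
  note cl = i(2) sc X.lact_closed X.ract_closed
  note tr = z a s l r cl inj i(6) cC
  have grp: "abelian_group Y"
  proof (rule abelian_groupI, goal_cases)
    case (1 x y) then show ?case by (auto dest!: ex simp: tr)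
  next
    case 2 then show ?case by (simp add: tr)
  next
    case (3 x y z) then show ?case by (auto dest!: ex simp: tr X.a_assoc)
  next
    case (4 x y) then show ?case by (auto dest!: ex simp: tr X.a_comm)
  next
    case (5 x) then show ?case by (auto dest!: ex simp: tr)
  next
    case (6 x)
    then obtain x' where x': "x' \<in> carrier X" "x = \<phi> x'" using ex by blast
    show ?case
      by (rule bexI[of _ "\<phi> (\<ominus>\<^bsub>X\<^esub> x')"]) (use x' in \<open>simp_all add: tr X.l_neg\<close>)
  qed
  have mod: "Module.module complex_field Y"
  proof (rule moduleI[OF cring_complex_field grp], goal_cases)
    case (1 k x) then show ?case by (auto dest!: ex simp: tr)
  next
    case (2 k j x) then show ?case
      using X.smult_l_distr[of k j] by (auto dest!: ex simp: tr)
  next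
    case (3 k x y) then show ?case
      using X.smult_r_distr[of k] by (auto dest!: ex simp: tr)
  next
    case (4 k j x) then show ?case
      using X.smult_assoc1[of k j] by (auto dest!: ex simp: tr)
  next
    case (5 x) then show ?case
      by (auto dest!: ex simp: tr X.one_smult)
  qed
  show ?thesis
  proof (intro normed_bimodule.intro complex_normed_space.intro mod, goal_cases)
    case 1
    show ?case
      by standard (auto dest!: ex simp: tr X.nrm_nonneg X.nrm_eq_0_iff X.nrm_smult X.nrm_triangle)
  next
    case 2
    show ?case
    proof (standard, goal_cases)
      case 14
      obtain K where "\<forall>c\<in>carrier C. \<forall>x\<in>carrier X. nrm X (lact X c x) \<le> K * nrm C c * nrm X x"
        using X.lact_bounded by blast
      then show ?case by (intro exI[of _ K]) (auto dest!: ex simp: tr)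
    next
      case 15
      obtain K where "\<forall>c\<in>carrier C. \<forall>x\<in>carrier X. nrm X (ract X x c) \<le> K * nrm C c * nrm X x"
        using X.ract_bounded by blast
      then show ?case by (intro exI[of _ K]) (auto dest!: ex simp: tr)
    qed (auto dest!: ex simp: tr X.lact_add X.ract_add X.lact_smult X.ract_smult
           X.add_lact X.add_ract X.smult_lact X.smult_ract X.lact_mult X.ract_mult X.lact_ract)
  qed
qed

lemma isometric_bimodules_refl: "isometric_bimodules C X X"
  unfolding isometric_bimodules_def isometric_bimodule_iso_def
  by (intro exI[of _ id]) auto

lemma isometric_bimodules_trans:
  assumes "isometric_bimodules C X Y" "isometric_bimodules C Y Z"
  shows "isometric_bimodules C X Z"
proof -
  obtain \<phi> \<psi> where i: "isometric_bimodule_iso C X Y \<phi>" and j: "isometric_bimodule_iso C Y Z \<psi>"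
    using assms unfolding isometric_bimodules_def by blast
  note ii = isometric_bimodule_isoD[OF i] and jj = isometric_bimodule_isoD[OF j]
  have "isometric_bimodule_iso C X Z (\<psi> \<circ> \<phi>)"
    unfolding isometric_bimodule_iso_def
    using bij_betw_trans[OF ii(1) jj(1)] by (auto simp: ii jj)
  then show ?thesis unfolding isometric_bimodules_def by blast
qed

lemma isometric_bimodules_sym:
  assumes X: "normed_bimodule C X" and "isometric_bimodules C X Y"
  shows "isometric_bimodules C Y X"
proof -
  interpret X: normed_bimodule C X by (rule X)
  obtain \<phi> where iso: "isometric_bimodule_iso C X Y \<phi>"
    using assms unfolding isometric_bimodules_def by blast
  note i = isometric_bimodule_isoD[OF iso]
  define \<psi> where "\<psi> = inv_into (carrier X) \<phi>"
  have \<psi>: "\<psi> (\<phi> x) = x" if "x \<in> carrier X" for x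
    using i(1) that unfolding \<psi>_def bij_betw_def by simp
  have ex: "\<exists>x\<in>carrier X. y = \<phi> x" if "y \<in> carrier Y" for y
    using that i(1) unfolding bij_betw_def by blast
  have sc: "k \<odot>\<^bsub>X\<^esub> x \<in> carrier X" if "x \<in> carrier X" for k x
    using X.smult_closed[of k x] that by simp
  have "isometric_bimodule_iso C Y X \<psi>"
    unfolding isometric_bimodule_iso_def
  proof (intro conjI ballI allI)
    show "bij_betw \<psi> (carrier Y) (carrier X)"
      unfolding \<psi>_def by (rule bij_betw_inv_into[OF i(1)])
  qed (auto dest!: ex simp: i(4,5,7,8)[symmetric] i(3)[symmetric] \<psi> sc X.lact_closed X.ract_closed i(6))
  then show ?thesis unfolding isometric_bimodules_def by blast
qed

lemma normed_bimodule_isometric: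
  "\<lbrakk>normed_bimodule C (self_bimodule C); normed_bimodule C X; isometric_bimodules C X Y\<rbrakk>
    \<Longrightarrow> normed_bimodule C Y"
  unfolding isometric_bimodules_def using normed_bimodule_iso by blast

context complex_normed_space
begin

lemma functional_zero: "bounded_functional X f \<Longrightarrow> f \<zero> = 0"
proof -
  assume "bounded_functional X f"
  then have "f (\<zero> \<oplus> \<zero>) = f \<zero> + f \<zero>"
    unfolding bounded_functional_def by blast
  then show ?thesis by simp
qed

abbreviation unit_ball :: "'x set"
  where "unit_ball \<equiv> {x \<in> carrier X. nrm X x \<le> 1}"

abbreviation functional_nrm :: "('x \<Rightarrow> complex) \<Rightarrow> real"
  where "functional_nrm f \<equiv> (SUP x\<in>unit_ball. cmod (f x))"

lemma zero_in_unit_ball: "\<zero> \<in> unit_ball"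
  using nrm_eq_0_iff[of \<zero>] by simp

lemma functional_bdd_above:
  assumes "bounded_functional X f"
  shows "bdd_above ((\<lambda>x. cmod (f x)) ` unit_ball)"
proof -
  obtain K where K: "\<And>x. x \<in> carrier X \<Longrightarrow> cmod (f x) \<le> K * nrm X x"
    using assms unfolding bounded_functional_def by blast
  have "cmod (f x) \<le> \<bar>K\<bar>" if "x \<in> unit_ball" for x
  proof -
    have "cmod (f x) \<le> \<bar>K\<bar> * nrm X x"
      using K[of x] that nrm_nonneg[of x] by (smt (verit) mem_Collect_eq mult_right_mono)
    also have "\<dots> \<le> \<bar>K\<bar> * 1"
      using that by (intro mult_left_mono) auto
    finally show ?thesis by simp
  qed
  then show ?thesis unfolding bdd_above_def by blast
qed

lemma functional_nrm_upper:
  "\<lbrakk>bounded_functional X f; x \<in> unit_ball\<rbrakk> \<Longrightarrow> cmod (f x) \<le> functional_nrm f"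
  by (rule cSUP_upper[OF _ functional_bdd_above])

lemma functional_nrm_nonneg: "bounded_functional X f \<Longrightarrow> 0 \<le> functional_nrm f"
  using functional_nrm_upper[OF _ zero_in_unit_ball, of f] functional_zero[of f] by simp

lemma functional_nrm_least:
  "(\<And>x. x \<in> unit_ball \<Longrightarrow> cmod (f x) \<le> K) \<Longrightarrow> functional_nrm f \<le> K"
  by (rule cSUP_least) (use zero_in_unit_ball in blast)+

lemma functional_nrm_bound:
  assumes f: "bounded_functional X f" and x: "x \<in> carrier X"
  shows "cmod (f x) \<le> functional_nrm f * nrm X x"
proof (cases "nrm X x = 0")
  case True
  then have "x = \<zero>" using x nrm_eq_0_iff by simp
  then show ?thesis using functional_zero[OF f] True by simp
next
  case False
  then have pos: "0 < nrm X x" using nrm_nonneg[OF x] by simp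
  define k where "k = complex_of_real (1 / nrm X x)"
  have k: "cmod k = 1 / nrm X x"
    unfolding k_def norm_of_real using pos by simp
  have "k \<odot> x \<in> unit_ball"
    using smult_closed[of k x] x pos by (simp add: nrm_smult k)
  then have "cmod (f (k \<odot> x)) \<le> functional_nrm f"
    by (rule functional_nrm_upper[OF f])
  moreover have "f (k \<odot> x) = k * f x"
    using f x unfolding bounded_functional_def by blast
  ultimately have "cmod (f x) / nrm X x \<le> functional_nrm f"
    by (simp add: norm_mult k)
  then show ?thesis using pos by (simp add: pos_divide_le_eq)
qed

end

lemma dual_bimodule_simps:
  "carrier (dual_bimodule X) = {f \<in> extensional (carrier X). bounded_functional X f}"
  "\<zero>\<^bsub>dual_bimodule X\<^esub> = (\<lambda>x\<in>carrier X. 0)"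
  "f \<oplus>\<^bsub>dual_bimodule X\<^esub> g = (\<lambda>x\<in>carrier X. f x + g x)"
  "k \<odot>\<^bsub>dual_bimodule X\<^esub> f = (\<lambda>x\<in>carrier X. k * f x)"
  "nrm (dual_bimodule X) f = (SUP x\<in>{x \<in> carrier X. nrm X x \<le> 1}. cmod (f x))"
  "lact (dual_bimodule X) c f = (\<lambda>x\<in>carrier X. f (ract X x c))"
  "ract (dual_bimodule X) f c = (\<lambda>x\<in>carrier X. f (lact X c x))"
  by (simp_all add: dual_bimodule_def)

context normed_bimodule
begin

lemma smult_in: "x \<in> carrier X \<Longrightarrow> k \<odot> x \<in> carrier X"
  using smult_closed[of k x] by simp

lemma bounded_functional_restrictI:
  assumes "\<And>x y. \<lbrakk>x \<in> carrier X; y \<in> carrier X\<rbrakk> \<Longrightarrow> h (x \<oplus> y) = h x + h y"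
    and "\<And>k x. x \<in> carrier X \<Longrightarrow> h (k \<odot> x) = k * h x"
    and "\<And>x. x \<in> carrier X \<Longrightarrow> cmod (h x) \<le> K * nrm X x"
  shows "bounded_functional X (\<lambda>x\<in>carrier X. h x)"
  unfolding bounded_functional_def
  using assms smult_in by (auto intro!: exI[of _ K])

lemma bounded_functionalD:
  assumes "bounded_functional X f"
  shows "\<lbrakk>x \<in> carrier X; y \<in> carrier X\<rbrakk> \<Longrightarrow> f (x \<oplus> y) = f x + f y"
    and "x \<in> carrier X \<Longrightarrow> f (k \<odot> x) = k * f x"
  using assms unfolding bounded_functional_def by blast+

lemma bounded_functional_add:
  assumes f: "bounded_functional X f" and g: "bounded_functional X g"
  shows "bounded_functional X (\<lambda>x\<in>carrier X. f x + g x)"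
proof (rule bounded_functional_restrictI)
  fix x assume x: "x \<in> carrier X"
  show "cmod (f x + g x) \<le> (functional_nrm f + functional_nrm g) * nrm X x"
    using norm_triangle_ineq[of "f x" "g x"] functional_nrm_bound[OF f x] functional_nrm_bound[OF g x]
    unfolding distrib_right by linarith
qed (simp_all add: bounded_functionalD[OF f] bounded_functionalD[OF g] algebra_simps)

lemma bounded_functional_smult:
  assumes f: "bounded_functional X f"
  shows "bounded_functional X (\<lambda>x\<in>carrier X. k * f x)"
proof (rule bounded_functional_restrictI)
  fix x assume x: "x \<in> carrier X"
  show "cmod (k * f x) \<le> (cmod k * functional_nrm f) * nrm X x"
    using mult_left_mono[OF functional_nrm_bound[OF f x], of "cmod k"]
    by (simp add: norm_mult mult.assoc)
qed (simp_all add: bounded_functionalD[OF f] algebra_simps)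

lemma bounded_functional_0: "bounded_functional X (\<lambda>x\<in>carrier X. 0)"
  by (rule bounded_functional_restrictI[where K = 0]) simp_all

lemma bounded_functional_ract:
  assumes f: "bounded_functional X f" and c: "c \<in> carrier C"
  shows "bounded_functional X (\<lambda>x\<in>carrier X. f (ract X x c))"
proof -
  obtain K where K: "\<And>x. x \<in> carrier X \<Longrightarrow> nrm X (ract X x c) \<le> K * nrm C c * nrm X x"
    using ract_bounded c by blast
  show ?thesis
  proof (rule bounded_functional_restrictI)
    fix x assume x: "x \<in> carrier X"
    have "cmod (f (ract X x c)) \<le> functional_nrm f * nrm X (ract X x c)"
      by (rule functional_nrm_bound[OF f ract_closed[OF c x]])
    also have "\<dots> \<le> functional_nrm f * (K * nrm C c * nrm X x)"
      by (rule mult_left_mono[OF K[OF x] functional_nrm_nonneg[OF f]])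
    finally show "cmod (f (ract X x c)) \<le> (functional_nrm f * (K * nrm C c)) * nrm X x"
      by (simp add: mult.assoc)
  qed (simp_all add: bounded_functionalD[OF f] c ract_add ract_smult ract_closed)
qed

lemma bounded_functional_lact:
  assumes f: "bounded_functional X f" and c: "c \<in> carrier C"
  shows "bounded_functional X (\<lambda>x\<in>carrier X. f (lact X c x))"
proof -
  obtain K where K: "\<And>x. x \<in> carrier X \<Longrightarrow> nrm X (lact X c x) \<le> K * nrm C c * nrm X x"
    using lact_bounded c by blast
  show ?thesis
  proof (rule bounded_functional_restrictI)
    fix x assume x: "x \<in> carrier X"
    have "cmod (f (lact X c x)) \<le> functional_nrm f * nrm X (lact X c x)"
      by (rule functional_nrm_bound[OF f lact_closed[OF c x]])
    also have "\<dots> \<le> functional_nrm f * (K * nrm C c * nrm X x)"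
      by (rule mult_left_mono[OF K[OF x] functional_nrm_nonneg[OF f]])
    finally show "cmod (f (lact X c x)) \<le> (functional_nrm f * (K * nrm C c)) * nrm X x"
      by (simp add: mult.assoc)
  qed (simp_all add: bounded_functionalD[OF f] c lact_add lact_smult lact_closed)
qed

lemmas bounded_functional_raw =
  bounded_functional_add[unfolded restrict_def] bounded_functional_smult[unfolded restrict_def]
  bounded_functional_0[unfolded restrict_def] bounded_functional_ract[unfolded restrict_def]
  bounded_functional_lact[unfolded restrict_def]

lemma functional_nrm_comp_le:
  assumes f: "bounded_functional X f"
    and t: "\<And>x. x \<in> carrier X \<Longrightarrow> t x \<in> carrier X"
    and K: "\<And>x. x \<in> carrier X \<Longrightarrow> nrm X (t x) \<le> K * nrm X x"
  shows "functional_nrm (\<lambda>x\<in>carrier X. f (t x)) \<le> K * functional_nrm f"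
proof (rule functional_nrm_least)
  fix x assume x: "x \<in> unit_ball"
  then have xc: "x \<in> carrier X" and x1: "nrm X x \<le> 1" by auto
  have "cmod (f (t x)) \<le> functional_nrm f * nrm X (t x)"
    by (rule functional_nrm_bound[OF f t[OF xc]])
  also have "\<dots> \<le> functional_nrm f * (K * nrm X x)"
    by (rule mult_left_mono[OF K[OF xc] functional_nrm_nonneg[OF f]])
  also have "\<dots> \<le> K * functional_nrm f"
  proof (cases "0 \<le> K")
    case True
    then have "functional_nrm f * (K * nrm X x) \<le> functional_nrm f * (K * 1)"
      by (intro mult_left_mono x1 functional_nrm_nonneg[OF f]) auto
    then show ?thesis by (simp add: mult.commute)
  next
    case False
    have zero: "nrm X y = 0" if "y \<in> carrier X" for y
    proof -
      have "0 \<le> K * nrm X y"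
        using K[OF that] nrm_nonneg[OF t[OF that]] by linarith
      then show ?thesis
        using False nrm_nonneg[OF that] by (simp add: zero_le_mult_iff)
    qed
    have "functional_nrm f \<le> 0"
      using functional_nrm_bound[OF f] zero by (intro functional_nrm_least) force
    then show ?thesis
      using functional_nrm_nonneg[OF f] by simp
  qed
  finally show "cmod ((\<lambda>x\<in>carrier X. f (t x)) x) \<le> K * functional_nrm f"
    using xc by simp
qed

lemma functional_nrm_smult_le:
  assumes f: "bounded_functional X f"
  shows "functional_nrm (\<lambda>x\<in>carrier X. k * f x) \<le> cmod k * functional_nrm f"
  by (rule functional_nrm_least)
    (auto simp: norm_mult intro!: mult_left_mono functional_nrm_upper[OF f])

lemma functional_nrm_smult:
  assumes f: "bounded_functional X f"
  shows "functional_nrm (\<lambda>x\<in>carrier X. k * f x) = cmod k * functional_nrm f"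
proof (cases "k = 0")
  case True
  have "0 \<le> functional_nrm (\<lambda>x\<in>carrier X. k * f x)"
    by (rule functional_nrm_nonneg[OF bounded_functional_smult[OF f]])
  then show ?thesis
    using functional_nrm_smult_le[OF f, of k] True by simp
next
  case False
  let ?g = "\<lambda>x\<in>carrier X. k * f x"
  have g: "bounded_functional X ?g" by (rule bounded_functional_smult[OF f])
  have "functional_nrm f = functional_nrm (\<lambda>x\<in>carrier X. inverse k * ?g x)"
    using False by (intro SUP_cong) (auto simp: mult.assoc[symmetric])
  also have "\<dots> \<le> cmod (inverse k) * functional_nrm ?g"
    by (rule functional_nrm_smult_le[OF g])
  finally have "cmod k * functional_nrm f \<le> functional_nrm ?g"
    using False by (simp add: norm_divide field_simps)
  then show ?thesis
    using functional_nrm_smult_le[OF f, of k] by linarith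
qed

lemma abelian_group_dual: "abelian_group (dual_bimodule X)"
proof (rule abelian_groupI, goal_cases)
  case (6 f)
  then have f: "f \<in> extensional (carrier X)" "bounded_functional X f"
    by (simp_all add: dual_bimodule_simps)
  show ?case
  proof (rule bexI)
    show "(\<lambda>x\<in>carrier X. (- 1) * f x) \<in> carrier (dual_bimodule X)"
      using bounded_functional_smult[OF f(2), of "- 1"] by (simp add: dual_bimodule_simps)
    show "(\<lambda>x\<in>carrier X. (- 1) * f x) \<oplus>\<^bsub>dual_bimodule X\<^esub> f = \<zero>\<^bsub>dual_bimodule X\<^esub>"
      by (auto simp: dual_bimodule_simps restrict_def)
  qed
next
  case (5 f)
  then show ?case
    by (auto simp: dual_bimodule_simps restrict_def extensional_def)
qed (auto simp: dual_bimodule_simps bounded_functional_raw restrict_def extensional_def fun_eq_iff add.assoc add.commute)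

lemma module_dual: "Module.module complex_field (dual_bimodule X)"
  by (rule moduleI[OF cring_complex_field abelian_group_dual])
    (auto simp: dual_bimodule_simps bounded_functional_raw algebra_simps restrict_def extensional_def fun_eq_iff)

theorem normed_bimodule_dual: "normed_bimodule C (dual_bimodule X)"
proof (intro normed_bimodule.intro complex_normed_space.intro module_dual, goal_cases)
  case 1
  show ?case
  proof (standard, goal_cases)
    case (1 f)
    then show ?case by (simp add: dual_bimodule_simps functional_nrm_nonneg)
  next
    case (2 f)
    then have f: "f \<in> extensional (carrier X)" "bounded_functional X f"
      by (simp_all add: dual_bimodule_simps)
    have "f = (\<lambda>x\<in>carrier X. 0)" if "functional_nrm f = 0"
      using functional_nrm_bound[OF f(2)] that f(1) by (intro extensionalityI[of _ "carrier X"]) auto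
    moreover have "functional_nrm f = 0" if "f = (\<lambda>x\<in>carrier X. 0)"
    proof -
      have "functional_nrm f \<le> 0"
        using that by (intro functional_nrm_least) auto
      then show ?thesis using functional_nrm_nonneg[OF f(2)] by linarith
    qed
    ultimately show ?case by (auto simp: dual_bimodule_simps)
  next
    case (3 f k)
    then show ?case
      using functional_nrm_smult[of f k] by (simp add: dual_bimodule_simps)
  next
    case (4 f g)
    then have f: "bounded_functional X f" and g: "bounded_functional X g"
      by (simp_all add: dual_bimodule_simps)
    have "functional_nrm (\<lambda>x\<in>carrier X. f x + g x) \<le> functional_nrm f + functional_nrm g"
    proof (rule functional_nrm_least)
      fix x assume x: "x \<in> unit_ball"
      show "cmod ((\<lambda>x\<in>carrier X. f x + g x) x) \<le> functional_nrm f + functional_nrm g"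
        using x norm_triangle_ineq[of "f x" "g x"] functional_nrm_upper[OF f x] functional_nrm_upper[OF g x]
        by simp
    qed
    then show ?case by (simp add: dual_bimodule_simps)
  qed
next
  case 2
  show ?case
  proof (standard, goal_cases)
    case 14
    obtain K where K: "\<And>c x. \<lbrakk>c \<in> carrier C; x \<in> carrier X\<rbrakk> \<Longrightarrow> nrm X (ract X x c) \<le> K * nrm C c * nrm X x"
      using ract_bounded by blast
    show ?case
    proof (intro exI ballI)
      fix c f assume c: "c \<in> carrier C" and "f \<in> carrier (dual_bimodule X)"
      then have f: "bounded_functional X f" by (simp add: dual_bimodule_simps)
      show "nrm (dual_bimodule X) (lact (dual_bimodule X) c f)
          \<le> K * nrm C c * nrm (dual_bimodule X) f"
        unfolding dual_bimodule_simps
        by (rule functional_nrm_comp_le[OF f ract_closed[OF c] K[OF c]])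
    qed
  next
    case 15
    obtain K where K: "\<And>c x. \<lbrakk>c \<in> carrier C; x \<in> carrier X\<rbrakk> \<Longrightarrow> nrm X (lact X c x) \<le> K * nrm C c * nrm X x"
      using lact_bounded by blast
    show ?case
    proof (intro exI ballI)
      fix c f assume c: "c \<in> carrier C" and "f \<in> carrier (dual_bimodule X)"
      then have f: "bounded_functional X f" by (simp add: dual_bimodule_simps)
      show "nrm (dual_bimodule X) (ract (dual_bimodule X) f c)
          \<le> K * nrm C c * nrm (dual_bimodule X) f"
        unfolding dual_bimodule_simps
        by (rule functional_nrm_comp_le[OF f lact_closed[OF c] K[OF c]])
    qed
  qed (auto simp: dual_bimodule_simps bounded_functional_raw
      bounded_functionalD restrict_def extensional_def lact_closed ract_closed lact_add ract_add lact_smult ract_smult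
      add_lact add_ract smult_lact smult_ract lact_mult ract_mult lact_ract fun_eq_iff)
qed

end

lemma isometric_bimodules_dual:
  fixes X :: "('c, 'x, 'n) bimodule_scheme" and Y :: "('c, 'y, 'k) bimodule_scheme"
  assumes C: "normed_bimodule C (self_bimodule C)"
    and X: "normed_bimodule C X" and XY: "isometric_bimodules C X Y"
  shows "isometric_bimodules C (dual_bimodule Y) (dual_bimodule X)"
proof -
  have Y: "normed_bimodule C Y" by (rule normed_bimodule_isometric[OF C X XY])
  interpret X: normed_bimodule C X by (rule X)
  interpret Y: normed_bimodule C Y by (rule Y)
  obtain \<phi> where iso: "isometric_bimodule_iso C X Y \<phi>"
    using XY unfolding isometric_bimodules_def by blast
  note i = isometric_bimodule_isoD[OF iso]
  define \<psi> where "\<psi> = inv_into (carrier X) \<phi>"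
  have \<psi>\<phi>: "\<psi> (\<phi> x) = x" if "x \<in> carrier X" for x
    using i(1) that unfolding \<psi>_def bij_betw_def by simp
  have \<phi>\<psi>: "\<phi> (\<psi> y) = y" "\<psi> y \<in> carrier X" if "y \<in> carrier Y" for y
    using i(1) that unfolding \<psi>_def bij_betw_def by (auto simp: f_inv_into_f inv_into_into)
  have \<psi>_add: "\<psi> (y \<oplus>\<^bsub>Y\<^esub> z) = \<psi> y \<oplus>\<^bsub>X\<^esub> \<psi> z" if "y \<in> carrier Y" "z \<in> carrier Y" for y z
    using \<psi>\<phi>[of "\<psi> y \<oplus>\<^bsub>X\<^esub> \<psi> z"] that \<phi>\<psi> i(4) by simp
  have \<psi>_smult: "\<psi> (k \<odot>\<^bsub>Y\<^esub> y) = k \<odot>\<^bsub>X\<^esub> \<psi> y" if "y \<in> carrier Y" for k y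
    using \<psi>\<phi>[of "k \<odot>\<^bsub>X\<^esub> \<psi> y"] that \<phi>\<psi> i(5) X.smult_in by simp
  have \<psi>_nrm: "nrm X (\<psi> y) = nrm Y y" if "y \<in> carrier Y" for y
    using i(6)[of "\<psi> y"] \<phi>\<psi> that by simp
  define F :: "('y \<Rightarrow> complex) \<Rightarrow> 'x \<Rightarrow> complex" where "F = (\<lambda>f. \<lambda>x\<in>carrier X. f (\<phi> x))"
  define G :: "('x \<Rightarrow> complex) \<Rightarrow> 'y \<Rightarrow> complex" where "G = (\<lambda>g. \<lambda>y\<in>carrier Y. g (\<psi> y))"
  have F: "bounded_functional X (F f)" if f: "bounded_functional Y f" for f
    unfolding F_def
  proof (rule X.bounded_functional_restrictI)
    show "cmod (f (\<phi> x)) \<le> Y.functional_nrm f * nrm X x" if "x \<in> carrier X" for x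
      using Y.functional_nrm_bound[OF f i(2)[OF that]] i(6)[OF that] by simp
  qed (simp_all add: i Y.bounded_functionalD[OF f])
  have G: "bounded_functional Y (G g)" if g: "bounded_functional X g" for g
    unfolding G_def
  proof (rule Y.bounded_functional_restrictI)
    show "cmod (g (\<psi> y)) \<le> X.functional_nrm g * nrm Y y" if "y \<in> carrier Y" for y
      using X.functional_nrm_bound[OF g \<phi>\<psi>(2)[OF that]] \<psi>_nrm[OF that] by simp
  qed (simp_all add: \<phi>\<psi> \<psi>_add \<psi>_smult X.bounded_functionalD[OF g])
  have "isometric_bimodule_iso C (dual_bimodule Y) (dual_bimodule X) F"
    unfolding isometric_bimodule_iso_def
  proof (intro conjI ballI allI)
    show "bij_betw F (carrier (dual_bimodule Y)) (carrier (dual_bimodule X))"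
    proof (rule bij_betw_byWitness[where f' = G])
      show "\<forall>f\<in>carrier (dual_bimodule Y). G (F f) = f"
        by (auto simp: dual_bimodule_simps F_def G_def \<phi>\<psi> intro!: extensionalityI[of _ "carrier Y"])
      show "\<forall>g\<in>carrier (dual_bimodule X). F (G g) = g"
        by (auto simp: dual_bimodule_simps F_def G_def \<psi>\<phi> i(2) intro!: extensionalityI[of _ "carrier X"])
      show "F ` carrier (dual_bimodule Y) \<subseteq> carrier (dual_bimodule X)"
        using F by (auto simp: dual_bimodule_simps F_def)
      show "G ` carrier (dual_bimodule X) \<subseteq> carrier (dual_bimodule Y)"
        using G by (auto simp: dual_bimodule_simps G_def)
    qed
    fix f assume "f \<in> carrier (dual_bimodule Y)"
    have "(\<lambda>y. cmod (f y)) ` {y \<in> carrier Y. nrm Y y \<le> 1} =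
          (\<lambda>x. cmod (F f x)) ` {x \<in> carrier X. nrm X x \<le> 1}" (is "?L = ?R")
    proof
      show "?L \<subseteq> ?R"
      proof
        fix v assume "v \<in> ?L"
        then obtain y where y: "y \<in> carrier Y" "nrm Y y \<le> 1" "v = cmod (f y)" by blast
        then have "v = cmod (F f (\<psi> y))" "\<psi> y \<in> {x \<in> carrier X. nrm X x \<le> 1}"
          by (simp_all add: F_def \<phi>\<psi> \<psi>_nrm)
        then show "v \<in> ?R" by blast
      qed
      show "?R \<subseteq> ?L" by (auto simp: F_def i)
    qed
    then show "nrm (dual_bimodule X) (F f) = nrm (dual_bimodule Y) f"
      by (simp add: dual_bimodule_simps)
  qed (auto simp: F_def dual_bimodule_simps restrict_def fun_eq_iff i
         X.lact_closed X.ract_closed Y.lact_closed Y.ract_closed)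
  then show ?thesis unfolding isometric_bimodules_def by blast
qed

lemma dual_tower_normed_bimodule:
  assumes C: "normed_bimodule C (self_bimodule C)" and T: "dual_tower C n T"
  shows "k \<le> n \<Longrightarrow> normed_bimodule C (T k)"
proof (induction k)
  case 0
  then show ?case
    using normed_bimodule_isometric[OF C C] T unfolding dual_tower_def by blast
next
  case (Suc k)
  then have "normed_bimodule C (dual_bimodule (T k))"
    by (simp add: normed_bimodule.normed_bimodule_dual)
  moreover have "isometric_bimodules C (dual_bimodule (T k)) (T (Suc k))"
    using Suc.prems T unfolding dual_tower_def by simp
  ultimately show ?case by (rule normed_bimodule_isometric[OF C])
qed

theorem dual_tower_unique:
  assumes C: "normed_bimodule C (self_bimodule C)"
    and S: "dual_tower C n S" and T: "dual_tower C n T"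
  shows "k \<le> n \<Longrightarrow> isometric_bimodules C (S k) (T k)"
proof (induction k)
  case 0
  have "isometric_bimodules C (S 0) (self_bimodule C)"
    using isometric_bimodules_sym[OF C] S unfolding dual_tower_def by blast
  moreover have "isometric_bimodules C (self_bimodule C) (T 0)"
    using T unfolding dual_tower_def by blast
  ultimately show ?case by (rule isometric_bimodules_trans)
next
  case (Suc k)
  then have k: "k < n" "k \<le> n" by simp_all
  have nS: "normed_bimodule C (S k)" by (rule dual_tower_normed_bimodule[OF C S k(2)])
  have nT: "normed_bimodule C (T k)" by (rule dual_tower_normed_bimodule[OF C T k(2)])
  have s: "isometric_bimodules C (dual_bimodule (S k)) (S (Suc k))"
    and t: "isometric_bimodules C (dual_bimodule (T k)) (T (Suc k))"
    using S T k(1) unfolding dual_tower_def by blast+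
  have "isometric_bimodules C (dual_bimodule (S k)) (dual_bimodule (T k))"
    by (rule isometric_bimodules_dual[OF C nT isometric_bimodules_sym[OF nS Suc.IH[OF k(2)]]])
  from isometric_bimodules_trans[OF isometric_bimodules_trans[OF
      isometric_bimodules_sym[OF normed_bimodule.normed_bimodule_dual[OF nS] s] this] t]
  show ?case .
qed

theorem dual_tower_0: "dual_tower C 0 (\<lambda>_. self_bimodule C)"
  by (simp add: dual_tower_def isometric_bimodules_refl)

definition transport_bimodule :: "('x \<Rightarrow> 'y) \<Rightarrow> ('c, 'x) bimodule \<Rightarrow> ('c, 'y) bimodule"
  where "transport_bimodule g X =
    \<lparr>carrier = g ` carrier X,
     mult = undefined,
     one = undefined,
     zero = g \<zero>\<^bsub>X\<^esub>,
     add = (\<lambda>x y. g (inv_into UNIV g x \<oplus>\<^bsub>X\<^esub> inv_into UNIV g y)),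
     smult = (\<lambda>k x. g (k \<odot>\<^bsub>X\<^esub> inv_into UNIV g x)),
     nrm = (\<lambda>x. nrm X (inv_into UNIV g x)),
     lact = (\<lambda>c x. g (lact X c (inv_into UNIV g x))),
     ract = (\<lambda>x c. g (ract X (inv_into UNIV g x) c))\<rparr>"

lemma isometric_transport_bimodule:
  assumes "inj g"
  shows "isometric_bimodules C X (transport_bimodule g X)"
proof -
  have "isometric_bimodule_iso C X (transport_bimodule g X) g"
    using inj_on_subset[OF assms subset_UNIV]
    unfolding isometric_bimodule_iso_def bij_betw_def
    by (simp add: transport_bimodule_def inv_f_f[OF assms])
  then show ?thesis unfolding isometric_bimodules_def by blast
qed

theorem dual_tower_Suc_ex:
  fixes T :: "nat \<Rightarrow> ('c, 'u) bimodule"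
  assumes C: "normed_bimodule C (self_bimodule C)" and T: "dual_tower C n T"
  shows "\<exists>T' :: nat \<Rightarrow> ('c, 'u + ('u \<Rightarrow> complex)) bimodule. dual_tower C (Suc n) T'"
proof -
  define L :: "nat \<Rightarrow> ('c, 'u + ('u \<Rightarrow> complex)) bimodule"
    where "L k = transport_bimodule Inl (T k)" for k
  define T' where "T' k = (if k \<le> n then L k else transport_bimodule Inr (dual_bimodule (T n)))" for k
  have L: "isometric_bimodules C (T k) (L k)" for k
    unfolding L_def by (rule isometric_transport_bimodule) simp
  have step: "isometric_bimodules C (dual_bimodule (L k)) (dual_bimodule (T k))" if "k \<le> n" for k
    by (rule isometric_bimodules_dual[OF C dual_tower_normed_bimodule[OF C T that] L])
  have "dual_tower C (Suc n) T'"
    unfolding dual_tower_def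
  proof (intro conjI allI impI)
    show "isometric_bimodules C (self_bimodule C) (T' 0)"
    proof -
      have "isometric_bimodules C (self_bimodule C) (T 0)"
        using T unfolding dual_tower_def by blast
      from isometric_bimodules_trans[OF this L] show ?thesis
        by (simp add: T'_def)
    qed
    fix k assume k: "k < Suc n"
    show "isometric_bimodules C (dual_bimodule (T' k)) (T' (Suc k))"
    proof (cases "k = n")
      case True
      have "isometric_bimodules C (dual_bimodule (T n)) (T' (Suc n))"
        unfolding T'_def by (simp add: isometric_transport_bimodule)
      from isometric_bimodules_trans[OF step this]
      show ?thesis
        using True by (simp add: T'_def)
    next
      case False
      with k have "k < n" by simp
      then have "isometric_bimodules C (dual_bimodule (T k)) (T (Suc k))"
        using T unfolding dual_tower_def by blast
      from isometric_bimodules_trans[OF isometric_bimodules_trans[OF step this] L]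
      show ?thesis
        using \<open>k < n\<close> by (simp add: T'_def)
    qed
  qed
  then show ?thesis by blast
qed

text \<open>The algebras of interest are normed bimodules over themselves, so the results above apply.\<close>

lemma with_actions_simps [simp]:
  "carrier (with_actions X l r) = carrier X"
  "mult (with_actions X l r) = mult X"
  "\<zero>\<^bsub>with_actions X l r\<^esub> = \<zero>\<^bsub>X\<^esub>"
  "add (with_actions X l r) = add X"
  "smult (with_actions X l r) = smult X"
  "nrm (with_actions X l r) = nrm X"
  "lact (with_actions X l r) = l"
  "ract (with_actions X l r) = r"
  by (simp_all add: with_actions_def)

lemma complex_normed_space_with_actions:
  assumes "complex_normed_space X"
  shows "complex_normed_space (with_actions X l r)"
proof -
  interpret X: complex_normed_space X by (rule assms)
  have grp: "abelian_group (with_actions X l r)"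
  proof (rule abelian_groupI, goal_cases)
    case (6 x)
    then show ?case by (intro bexI[of _ "\<ominus>\<^bsub>X\<^esub> x"]) (simp_all add: X.l_neg)
  qed (simp_all add: X.add.m_ac)
  have "Module.module complex_field (with_actions X l r)"
    by (rule moduleI[OF cring_complex_field grp])
      (use X.smult_closed X.smult_l_distr X.smult_r_distr X.smult_assoc1 X.one_smult in simp_all)
  then show ?thesis
    by (intro complex_normed_space.intro complex_normed_space_axioms.intro)
      (simp_all add: X.nrm_nonneg X.nrm_eq_0_iff X.nrm_smult X.nrm_triangle)
qed

theorem normed_bimodule_self:
  assumes "banach_algebra C"
  shows "normed_bimodule C (self_bimodule C)"
proof -
  interpret C: banach_algebra C by (rule assms)
  show ?thesis
    unfolding self_bimodule_def
  proof (intro normed_bimodule.intro complex_normed_space_with_actions C.complex_normed_space_axioms,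
      standard, goal_cases)
    case 14 show ?case using C.nrm_mult by (intro exI[of _ 1]) simp
  next
    case 15
    have "nrm C (x \<otimes>\<^bsub>C\<^esub> c) \<le> nrm C c * nrm C x" if "c \<in> carrier C" "x \<in> carrier C" for c x
      using C.nrm_mult[OF that(2,1)] by (simp add: mult.commute)
    then show ?case by (intro exI[of _ 1]) simp
  qed (simp_all add: C.mult_closed C.mult_add_left C.mult_add_right C.mult_smult_left
      C.mult_smult_right C.mult_assoc)
qed

lemma amalgamated_duplication_simps [simp]:
  "carrier (amalgamated_duplication A B l r) = carrier A \<times> carrier B"
  "(a, \<beta>) \<otimes>\<^bsub>amalgamated_duplication A B l r\<^esub> (b, \<gamma>) =
    (a \<otimes>\<^bsub>A\<^esub> b \<oplus>\<^bsub>A\<^esub> r a \<gamma> \<oplus>\<^bsub>A\<^esub> l \<beta> b, \<beta> \<otimes>\<^bsub>B\<^esub> \<gamma>)"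
  "\<zero>\<^bsub>amalgamated_duplication A B l r\<^esub> = (\<zero>\<^bsub>A\<^esub>, \<zero>\<^bsub>B\<^esub>)"
  "(a, \<beta>) \<oplus>\<^bsub>amalgamated_duplication A B l r\<^esub> (b, \<gamma>) = (a \<oplus>\<^bsub>A\<^esub> b, \<beta> \<oplus>\<^bsub>B\<^esub> \<gamma>)"
  "k \<odot>\<^bsub>amalgamated_duplication A B l r\<^esub> (a, \<beta>) = (k \<odot>\<^bsub>A\<^esub> a, k \<odot>\<^bsub>B\<^esub> \<beta>)"
  "nrm (amalgamated_duplication A B l r) (a, \<beta>) = nrm A a + nrm B \<beta>"
  by (simp_all add: amalgamated_duplication_def)

theorem normed_bimodule_self_amalgamated_duplication:
  fixes A :: "'a normed_space" and B :: "'b normed_space"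
  assumes A: "banach_algebra A" and B: "banach_algebra B"
    and M: "banach_bimodule B (with_actions A l r)" and comp: "compatible_actions A B l r"
  defines "P \<equiv> amalgamated_duplication A B l r"
  shows "normed_bimodule P (self_bimodule P)"
proof -
  interpret A: banach_algebra A by (rule A)
  interpret B: banach_algebra B by (rule B)
  interpret M: banach_bimodule B "with_actions A l r" by (rule M)
  note Asm = A.smult_closed[simplified] A.smult_l_distr[simplified] A.smult_r_distr[simplified]
    A.smult_assoc1[simplified] A.one_smult
  note Bsm = B.smult_closed[simplified] B.smult_l_distr[simplified] B.smult_r_distr[simplified]
    B.smult_assoc1[simplified] B.one_smult
  note act = M.lact_closed[simplified] M.ract_closed[simplified] M.lact_add[simplified]
    M.ract_add[simplified] M.lact_smult[simplified] M.ract_smult[simplified] M.add_lact[simplified]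
    M.add_ract[simplified] M.smult_lact[simplified] M.smult_ract[simplified] M.lact_mult[simplified]
    M.ract_mult[simplified] M.lact_ract[simplified]
  have co: "l \<beta> (a \<otimes>\<^bsub>A\<^esub> b) = l \<beta> a \<otimes>\<^bsub>A\<^esub> b"
    "r (a \<otimes>\<^bsub>A\<^esub> b) \<beta> = a \<otimes>\<^bsub>A\<^esub> r b \<beta>" "a \<otimes>\<^bsub>A\<^esub> l \<beta> b = r a \<beta> \<otimes>\<^bsub>A\<^esub> b"
    if "a \<in> carrier A" "b \<in> carrier A" "\<beta> \<in> carrier B" for a b \<beta>
    using comp that unfolding compatible_actions_def by blast+
  note mul = A.mult_closed B.mult_closed A.mult_assoc B.mult_assoc A.mult_add_left A.mult_add_right
    B.mult_add_left B.mult_add_right A.mult_smult_left A.mult_smult_right B.mult_smult_left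
    B.mult_smult_right
  have grp: "abelian_group P"
    unfolding P_def
  proof (rule abelian_groupI, goal_cases)
    case (6 x)
    then obtain a b where ab: "a \<in> carrier A" "b \<in> carrier B" "x = (a, b)" by auto
    show ?case
      by (rule bexI[of _ "(\<ominus>\<^bsub>A\<^esub> a, \<ominus>\<^bsub>B\<^esub> b)"]) (use ab in \<open>simp_all add: A.l_neg B.l_neg\<close>)
  qed (auto simp: A.add.m_ac B.add.m_ac)
  have mod: "Module.module complex_field P"
    by (rule moduleI[OF cring_complex_field grp]) (auto simp: P_def Asm Bsm)
  have ns: "complex_normed_space P"
  proof (intro complex_normed_space.intro mod, standard, goal_cases)
    case (1 x)
    then show ?case by (auto simp: P_def A.nrm_nonneg B.nrm_nonneg)
  next
    case (2 x)
    then show ?case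
      by (auto simp: P_def A.nrm_nonneg B.nrm_nonneg add_nonneg_eq_0_iff A.nrm_eq_0_iff B.nrm_eq_0_iff)
  next
    case (3 x k)
    then show ?case by (auto simp: P_def A.nrm_smult B.nrm_smult distrib_left)
  next
    case (4 x y)
    then obtain a b c d where "x = (a, b)" "y = (c, d)" "a \<in> carrier A" "b \<in> carrier B"
      "c \<in> carrier A" "d \<in> carrier B" by (auto simp: P_def)
    then show ?case
      using A.nrm_triangle[of a c] B.nrm_triangle[of b d] by (simp add: P_def)
  qed
  obtain K where K: "\<And>\<beta> a. \<lbrakk>\<beta> \<in> carrier B; a \<in> carrier A\<rbrakk> \<Longrightarrow> nrm A (l \<beta> a) \<le> K * nrm B \<beta> * nrm A a"
    using M.lact_bounded[simplified] by blast
  obtain L where L: "\<And>\<beta> a. \<lbrakk>\<beta> \<in> carrier B; a \<in> carrier A\<rbrakk> \<Longrightarrow> nrm A (r a \<beta>) \<le> L * nrm B \<beta> * nrm A a"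
    using M.ract_bounded[simplified] by blast
  have bnd: "nrm P (x \<otimes>\<^bsub>P\<^esub> y) \<le> (1 + \<bar>K\<bar> + \<bar>L\<bar>) * nrm P x * nrm P y"
    if "x \<in> carrier P" "y \<in> carrier P" for x y
  proof -
    obtain a b c d where xy: "x = (a, b)" "y = (c, d)" "a \<in> carrier A" "b \<in> carrier B"
      "c \<in> carrier A" "d \<in> carrier B" using \<open>x \<in> carrier P\<close> \<open>y \<in> carrier P\<close> by (auto simp: P_def)
    define p q s t where "p = nrm A a" and "q = nrm B b" and "s = nrm A c" and "t = nrm B d"
    have pos: "0 \<le> p" "0 \<le> q" "0 \<le> s" "0 \<le> t"
      using xy by (simp_all add: p_def q_def s_def t_def A.nrm_nonneg B.nrm_nonneg)
    have "nrm A (a \<otimes>\<^bsub>A\<^esub> c \<oplus>\<^bsub>A\<^esub> r a d \<oplus>\<^bsub>A\<^esub> l b c) \<le> nrm A (a \<otimes>\<^bsub>A\<^esub> c) + nrm A (r a d) + nrm A (l b c)"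
      using A.nrm_triangle[of "a \<otimes>\<^bsub>A\<^esub> c \<oplus>\<^bsub>A\<^esub> r a d" "l b c"] A.nrm_triangle[of "a \<otimes>\<^bsub>A\<^esub> c" "r a d"] xy
      by (simp add: mul act)
    moreover have "nrm A (a \<otimes>\<^bsub>A\<^esub> c) \<le> p * s" "nrm B (b \<otimes>\<^bsub>B\<^esub> d) \<le> q * t"
      using A.nrm_mult B.nrm_mult xy by (simp_all add: p_def q_def s_def t_def)
    moreover have "nrm A (r a d) \<le> \<bar>L\<bar> * (p * t)"
    proof -
      have "nrm A (r a d) \<le> L * (p * t)"
        using L[of d a] xy by (simp add: p_def t_def mult_ac)
      also have "\<dots> \<le> \<bar>L\<bar> * (p * t)"
        using pos by (intro mult_right_mono) auto
      finally show ?thesis .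
    qed
    moreover have "nrm A (l b c) \<le> \<bar>K\<bar> * (q * s)"
    proof -
      have "nrm A (l b c) \<le> K * (q * s)"
        using K[of b c] xy by (simp add: q_def s_def mult_ac)
      also have "\<dots> \<le> \<bar>K\<bar> * (q * s)"
        using pos by (intro mult_right_mono) auto
      finally show ?thesis .
    qed
    ultimately have "nrm P (x \<otimes>\<^bsub>P\<^esub> y) \<le> p * s + \<bar>L\<bar> * (p * t) + \<bar>K\<bar> * (q * s) + q * t"
      using xy by (simp add: P_def)
    also have "\<dots> \<le> (1 + \<bar>K\<bar> + \<bar>L\<bar>) * (p + q) * (s + t)"
    proof -
      have "0 \<le> p * t + q * s + \<bar>K\<bar> * (p * s + p * t + q * t) + \<bar>L\<bar> * (p * s + q * s + q * t)"
        using pos by (intro add_nonneg_nonneg mult_nonneg_nonneg) auto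
      then show ?thesis by (simp add: algebra_simps)
    qed
    finally show ?thesis
      using xy by (simp add: P_def p_def q_def s_def t_def)
  qed
  have mul_P: "x \<otimes>\<^bsub>P\<^esub> y \<in> carrier P" if "x \<in> carrier P" "y \<in> carrier P" for x y
    using that by (auto simp: P_def mul act)
  have add_P: "(x \<oplus>\<^bsub>P\<^esub> y) \<otimes>\<^bsub>P\<^esub> z = x \<otimes>\<^bsub>P\<^esub> z \<oplus>\<^bsub>P\<^esub> y \<otimes>\<^bsub>P\<^esub> z"
    "z \<otimes>\<^bsub>P\<^esub> (x \<oplus>\<^bsub>P\<^esub> y) = z \<otimes>\<^bsub>P\<^esub> x \<oplus>\<^bsub>P\<^esub> z \<otimes>\<^bsub>P\<^esub> y"
    if "x \<in> carrier P" "y \<in> carrier P" "z \<in> carrier P" for x y z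
    using that by (auto simp: P_def mul act A.add.m_ac)
  have smult_P: "(k \<odot>\<^bsub>P\<^esub> x) \<otimes>\<^bsub>P\<^esub> y = k \<odot>\<^bsub>P\<^esub> (x \<otimes>\<^bsub>P\<^esub> y)"
    "x \<otimes>\<^bsub>P\<^esub> (k \<odot>\<^bsub>P\<^esub> y) = k \<odot>\<^bsub>P\<^esub> (x \<otimes>\<^bsub>P\<^esub> y)"
    if "x \<in> carrier P" "y \<in> carrier P" for k x y
    using that by (auto simp: P_def mul act Asm)
  have assoc_P: "(x \<otimes>\<^bsub>P\<^esub> y) \<otimes>\<^bsub>P\<^esub> z = x \<otimes>\<^bsub>P\<^esub> (y \<otimes>\<^bsub>P\<^esub> z)"
    if "x \<in> carrier P" "y \<in> carrier P" "z \<in> carrier P" for x y z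
    using that by (auto simp: P_def mul act co A.add.m_ac)
  show ?thesis
    unfolding self_bimodule_def
  proof (intro normed_bimodule.intro complex_normed_space_with_actions ns, standard, goal_cases)
    case 14 show ?case using bnd by (intro exI[of _ "1 + \<bar>K\<bar> + \<bar>L\<bar>"]) simp
  next
    case 15
    have "nrm P (x \<otimes>\<^bsub>P\<^esub> c) \<le> (1 + \<bar>K\<bar> + \<bar>L\<bar>) * nrm P c * nrm P x"
      if "c \<in> carrier P" "x \<in> carrier P" for c x
      using bnd[OF that(2,1)] by (simp add: mult_ac)
    then show ?case by (intro exI[of _ "1 + \<bar>K\<bar> + \<bar>L\<bar>"]) simp
  qed (simp_all add: mul_P add_P smult_P assoc_P)
qed

end

theory Submission
  imports Defs
begin

text \<open>
  Let \<open>e\<close> be the unit of \<open>A\<close> and put \<open>\<psi> \<beta> = \<beta> \<cdot> e\<close>.  Compatibility turns the actions of \<open>B\<close> on \<open>A\<close>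
  into multiplications, \<open>\<beta> \<cdot> a = \<beta> \<cdot> (e a) = \<psi> \<beta> a\<close> and \<open>a \<cdot> \<beta> = a \<psi> \<beta>\<close>, the latter because
  \<open>e \<cdot> \<beta> = (e \<cdot> \<beta>) e = e (\<beta> \<cdot> e) = \<psi> \<beta>\<close>; moreover \<open>\<psi>\<close> is a bounded homomorphism.  Hence
  \<open>(a, \<beta>) \<mapsto> (a + \<psi> \<beta>, \<beta>)\<close> is an isomorphism of the amalgamated duplication onto the direct product
  of the algebras \<open>A\<close> and \<open>B\<close> (lemma \<open>amalgamated_duplication_decomposition\<close>), bounded in both
  directions, though in general not isometric.

  The dual of a direct sum of bimodules is the direct sum of the duals, so for a direct product
  \<open>C\<close> of \<open>A\<close> and \<open>B\<close> the bimodule \<open>C\<^sup>(\<^sup>n\<^sup>)\<close> is the direct sum of \<open>A\<^sup>(\<^sup>n\<^sup>)\<close> and \<open>B\<^sup>(\<^sup>n\<^sup>)\<close>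
  (lemma \<open>dual_tower_decomposition\<close>).  A derivation of \<open>C\<close> into this sum has four components.  The
  two mixed ones vanish because \<open>A\<close> is unital, and the other two are derivations
  \<open>A \<rightarrow> A\<^sup>(\<^sup>n\<^sup>)\<close> and \<open>B \<rightarrow> B\<^sup>(\<^sup>n\<^sup>)\<close>, so they are inner if \<open>A\<close> and \<open>B\<close> are \<open>n\<close>-weakly amenable
  (lemma \<open>inner_derivations_direct_sum\<close>).  Conversely, a derivation of \<open>A\<close> or \<open>B\<close> is a component
  of a derivation of \<open>C\<close>, and an element implementing the latter projects to one implementing the
  former (lemma \<open>inner_derivations_retract\<close>).

  Direct sums are described by projections and injections rather than by pairs.  One summand then
  is an equivariant retract, a notion that dualization preserves by exchanging its two maps, that
  is closed under composition and that contains the isomorphisms of a dual tower; this is what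
  carries the decomposition from level to level.
\<close>
section \<open>Bounded linear maps\<close>

definition bounded_linear_map ::
  "('x, 'm) normed_space_scheme \<Rightarrow> ('y, 'n) normed_space_scheme \<Rightarrow> ('x \<Rightarrow> 'y) \<Rightarrow> bool"
  where "bounded_linear_map X Y f \<longleftrightarrow>
    f \<in> carrier X \<rightarrow> carrier Y \<and>
    (\<forall>x\<in>carrier X. \<forall>y\<in>carrier X. f (x \<oplus>\<^bsub>X\<^esub> y) = f x \<oplus>\<^bsub>Y\<^esub> f y) \<and>
    (\<forall>k. \<forall>x\<in>carrier X. f (k \<odot>\<^bsub>X\<^esub> x) = k \<odot>\<^bsub>Y\<^esub> f x) \<and>
    (\<exists>K. \<forall>x\<in>carrier X. nrm Y (f x) \<le> K * nrm X x)"

lemma bounded_linear_mapI: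
  assumes "\<And>x. x \<in> carrier X \<Longrightarrow> f x \<in> carrier Y"
    and "\<And>x y. \<lbrakk>x \<in> carrier X; y \<in> carrier X\<rbrakk> \<Longrightarrow> f (x \<oplus>\<^bsub>X\<^esub> y) = f x \<oplus>\<^bsub>Y\<^esub> f y"
    and "\<And>k x. x \<in> carrier X \<Longrightarrow> f (k \<odot>\<^bsub>X\<^esub> x) = k \<odot>\<^bsub>Y\<^esub> f x"
    and "\<And>x. x \<in> carrier X \<Longrightarrow> nrm Y (f x) \<le> K * nrm X x"
  shows "bounded_linear_map X Y f"
  unfolding bounded_linear_map_def using assms by blast

lemma bounded_linear_mapD:
  assumes "bounded_linear_map X Y f"
  shows "x \<in> carrier X \<Longrightarrow> f x \<in> carrier Y"
    and "\<lbrakk>x \<in> carrier X; y \<in> carrier X\<rbrakk> \<Longrightarrow> f (x \<oplus>\<^bsub>X\<^esub> y) = f x \<oplus>\<^bsub>Y\<^esub> f y"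
    and "x \<in> carrier X \<Longrightarrow> f (k \<odot>\<^bsub>X\<^esub> x) = k \<odot>\<^bsub>Y\<^esub> f x"
  using assms unfolding bounded_linear_map_def by auto

lemma bounded_linear_map_bound:
  assumes "bounded_linear_map X Y f" and X: "complex_normed_space X"
  obtains K where "0 \<le> K" "\<And>x. x \<in> carrier X \<Longrightarrow> nrm Y (f x) \<le> K * nrm X x"
proof -
  obtain K where K: "\<And>x. x \<in> carrier X \<Longrightarrow> nrm Y (f x) \<le> K * nrm X x"
    using assms(1) unfolding bounded_linear_map_def by blast
  have "nrm Y (f x) \<le> \<bar>K\<bar> * nrm X x" if "x \<in> carrier X" for x
  proof -
    have "K * nrm X x \<le> \<bar>K\<bar> * nrm X x"
      using complex_normed_space.nrm_nonneg[OF X that] by (intro mult_right_mono) auto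
    then show ?thesis using K[OF that] by linarith
  qed
  then show thesis by (intro that[of "\<bar>K\<bar>"]) auto
qed

lemma bounded_linear_map_comp:
  assumes f: "bounded_linear_map X Y f" and g: "bounded_linear_map Y Z g"
    and X: "complex_normed_space X" and Y: "complex_normed_space Y"
  shows "bounded_linear_map X Z (g \<circ> f)"
proof -
  obtain K where K: "0 \<le> K" "\<And>x. x \<in> carrier X \<Longrightarrow> nrm Y (f x) \<le> K * nrm X x"
    using bounded_linear_map_bound[OF f X] by blast
  obtain L where L: "0 \<le> L" "\<And>y. y \<in> carrier Y \<Longrightarrow> nrm Z (g y) \<le> L * nrm Y y"
    using bounded_linear_map_bound[OF g Y] by blast
  note fD = bounded_linear_mapD[OF f] and gD = bounded_linear_mapD[OF g]
  show ?thesis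
  proof (rule bounded_linear_mapI)
    fix x assume x: "x \<in> carrier X"
    have "nrm Z (g (f x)) \<le> L * nrm Y (f x)" by (rule L(2)[OF fD(1)[OF x]])
    also have "\<dots> \<le> L * (K * nrm X x)" by (rule mult_left_mono[OF K(2)[OF x] L(1)])
    finally show "nrm Z ((g \<circ> f) x) \<le> (L * K) * nrm X x" by (simp add: mult.assoc)
  qed (simp_all add: fD gD)
qed

lemma bounded_linear_map_zero:
  assumes f: "bounded_linear_map X Y f"
    and X: "complex_normed_space X" and Y: "complex_normed_space Y"
  shows "f \<zero>\<^bsub>X\<^esub> = \<zero>\<^bsub>Y\<^esub>"
proof -
  interpret X: complex_normed_space X by (rule X)
  interpret Y: complex_normed_space Y by (rule Y)
  have "f (0 \<odot>\<^bsub>X\<^esub> \<zero>\<^bsub>X\<^esub>) = 0 \<odot>\<^bsub>Y\<^esub> f \<zero>\<^bsub>X\<^esub>"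
    by (rule bounded_linear_mapD(3)[OF f]) simp
  then show ?thesis
    using X.smult_l_null[of "\<zero>\<^bsub>X\<^esub>"] Y.smult_l_null[of "f \<zero>\<^bsub>X\<^esub>"] bounded_linear_mapD(1)[OF f]
    by simp
qed

lemma bounded_linear_map_diff:
  assumes f: "bounded_linear_map X Y f"
    and X: "complex_normed_space X" and Y: "complex_normed_space Y"
    and x: "x \<in> carrier X" and y: "y \<in> carrier X"
  shows "f (x \<ominus>\<^bsub>X\<^esub> y) = f x \<ominus>\<^bsub>Y\<^esub> f y"
proof -
  interpret X: complex_normed_space X by (rule X)
  interpret Y: complex_normed_space Y by (rule Y)
  note fD = bounded_linear_mapD[OF f]
  have "f (\<ominus>\<^bsub>X\<^esub> y) = \<ominus>\<^bsub>Y\<^esub> f y"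
    using fD(3)[OF y, of "- 1"] X.smult_minus_one[OF y] Y.smult_minus_one[OF fD(1)[OF y]] by simp
  then show ?thesis
    using fD(2)[OF x X.a_inv_closed[OF y]] by (simp add: a_minus_def)
qed

text \<open>
  The domain appears as an argument because the elements of a dual bimodule are extensional on
  the carrier.
\<close>
definition transpose_map ::
  "('x, 'm) normed_space_scheme \<Rightarrow> ('x \<Rightarrow> 'y) \<Rightarrow> ('y \<Rightarrow> complex) \<Rightarrow> 'x \<Rightarrow> complex"
  where "transpose_map X f g = (\<lambda>x\<in>carrier X. g (f x))"

lemma bounded_linear_map_transpose:
  assumes f: "bounded_linear_map X Y f"
    and X: "normed_bimodule C X" and Y: "normed_bimodule D Y"
  shows "bounded_linear_map (dual_bimodule Y) (dual_bimodule X) (transpose_map X f)"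
proof -
  interpret X: normed_bimodule C X by (rule X)
  interpret Y: normed_bimodule D Y by (rule Y)
  note fD = bounded_linear_mapD[OF f]
  obtain K where K: "0 \<le> K" "\<And>x. x \<in> carrier X \<Longrightarrow> nrm Y (f x) \<le> K * nrm X x"
    using bounded_linear_map_bound[OF f X.complex_normed_space_axioms] by blast
  have pt: "cmod (g (f x)) \<le> (K * Y.functional_nrm g) * nrm X x"
    if g: "bounded_functional Y g" and x: "x \<in> carrier X" for g x
  proof -
    have "cmod (g (f x)) \<le> Y.functional_nrm g * nrm Y (f x)"
      by (rule Y.functional_nrm_bound[OF g fD(1)[OF x]])
    also have "\<dots> \<le> Y.functional_nrm g * (K * nrm X x)"
      by (rule mult_left_mono[OF K(2)[OF x] Y.functional_nrm_nonneg[OF g]])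
    finally show ?thesis by (simp add: mult_ac)
  qed
  show ?thesis
  proof (rule bounded_linear_mapI)
    fix g assume "g \<in> carrier (dual_bimodule Y)"
    then have g: "bounded_functional Y g" by (simp add: dual_bimodule_simps)
    show "transpose_map X f g \<in> carrier (dual_bimodule X)"
      using X.bounded_functional_restrictI[of "\<lambda>x. g (f x)", OF _ _ pt[OF g]]
      by (simp add: dual_bimodule_simps transpose_map_def fD Y.bounded_functionalD[OF g])
    show "nrm (dual_bimodule X) (transpose_map X f g) \<le> K * nrm (dual_bimodule Y) g"
      unfolding dual_bimodule_simps transpose_map_def
    proof (rule X.functional_nrm_least)
      fix x assume x: "x \<in> X.unit_ball"
      have "(K * Y.functional_nrm g) * nrm X x \<le> (K * Y.functional_nrm g) * 1"
        using x K(1) Y.functional_nrm_nonneg[OF g] by (intro mult_left_mono) auto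
      then show "cmod ((\<lambda>x\<in>carrier X. g (f x)) x) \<le> K * Y.functional_nrm g"
        using pt[OF g, of x] x by simp
    qed
  qed (auto simp: dual_bimodule_simps transpose_map_def fD fun_eq_iff restrict_def)
qed


section \<open>Equivariant retracts of bimodules\<close>

text \<open>
  With \<open>C\<close> acting on the \<open>A\<close>-bimodule \<open>X\<close> through \<open>\<pi>\<close>, the maps \<open>p\<close> and \<open>i\<close> exhibit \<open>X\<close> as a direct
  summand of the \<open>C\<close>-bimodule \<open>U\<close>.  All conditions on \<open>p\<close> and \<open>i\<close> are invariant under passing to
  the duals and exchanging the two maps.
\<close>
definition equivariant_retract ::
  "('c, 'm) normed_space_scheme \<Rightarrow> ('a, 'n) normed_space_scheme \<Rightarrow> ('c \<Rightarrow> 'a) \<Rightarrow>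
   ('c, 'u, 'k) bimodule_scheme \<Rightarrow> ('a, 'x, 'l) bimodule_scheme \<Rightarrow> ('u \<Rightarrow> 'x) \<Rightarrow> ('x \<Rightarrow> 'u) \<Rightarrow> bool"
  where "equivariant_retract C A \<pi> U X p i \<longleftrightarrow>
    \<pi> \<in> carrier C \<rightarrow> carrier A \<and>
    bounded_linear_map U X p \<and> bounded_linear_map X U i \<and>
    (\<forall>x\<in>carrier X. p (i x) = x) \<and>
    (\<forall>c\<in>carrier C. \<forall>u\<in>carrier U.
       p (lact U c u) = lact X (\<pi> c) (p u) \<and> p (ract U u c) = ract X (p u) (\<pi> c)) \<and>
    (\<forall>c\<in>carrier C. \<forall>x\<in>carrier X.
       i (lact X (\<pi> c) x) = lact U c (i x) \<and> i (ract X x (\<pi> c)) = ract U (i x) c)"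

lemma equivariant_retractD:
  assumes "equivariant_retract C A \<pi> U X p i"
  shows "c \<in> carrier C \<Longrightarrow> \<pi> c \<in> carrier A"
    and "bounded_linear_map U X p" and "bounded_linear_map X U i"
    and "x \<in> carrier X \<Longrightarrow> p (i x) = x"
    and "\<lbrakk>c \<in> carrier C; u \<in> carrier U\<rbrakk> \<Longrightarrow> p (lact U c u) = lact X (\<pi> c) (p u)"
    and "\<lbrakk>c \<in> carrier C; u \<in> carrier U\<rbrakk> \<Longrightarrow> p (ract U u c) = ract X (p u) (\<pi> c)"
    and "\<lbrakk>c \<in> carrier C; x \<in> carrier X\<rbrakk> \<Longrightarrow> i (lact X (\<pi> c) x) = lact U c (i x)"
    and "\<lbrakk>c \<in> carrier C; x \<in> carrier X\<rbrakk> \<Longrightarrow> i (ract X x (\<pi> c)) = ract U (i x) c"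
  using assms unfolding equivariant_retract_def by auto

lemma equivariant_retract_comp:
  assumes r: "equivariant_retract C A \<pi> U X p i" and s: "equivariant_retract A B \<rho> X Y q j"
    and U: "complex_normed_space U" and X: "complex_normed_space X" and Y: "complex_normed_space Y"
  shows "equivariant_retract C B (\<rho> \<circ> \<pi>) U Y (q \<circ> p) (i \<circ> j)"
proof -
  note rD = equivariant_retractD[OF r] and sD = equivariant_retractD[OF s]
  note cl = bounded_linear_mapD(1)[OF rD(2)] bounded_linear_mapD(1)[OF rD(3)]
    bounded_linear_mapD(1)[OF sD(2)] bounded_linear_mapD(1)[OF sD(3)]
  show ?thesis
    unfolding equivariant_retract_def
    using bounded_linear_map_comp[OF rD(2) sD(2) U X] bounded_linear_map_comp[OF sD(3) rD(3) Y X]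
    by (auto simp: rD(1,4-8) sD(1,4-8) cl)
qed

lemma equivariant_retract_dual:
  assumes r: "equivariant_retract C A \<pi> U X p i"
    and U: "normed_bimodule C U" and X: "normed_bimodule A X"
  shows "equivariant_retract C A \<pi> (dual_bimodule U) (dual_bimodule X)
    (transpose_map X i) (transpose_map U p)"
proof -
  interpret U: normed_bimodule C U by (rule U)
  interpret X: normed_bimodule A X by (rule X)
  note rD = equivariant_retractD[OF r]
  note cl = bounded_linear_mapD(1)[OF rD(2)] bounded_linear_mapD(1)[OF rD(3)]
    U.lact_closed U.ract_closed X.lact_closed X.ract_closed
  show ?thesis
    unfolding equivariant_retract_def
    using bounded_linear_map_transpose[OF rD(2) U X] bounded_linear_map_transpose[OF rD(3) X U]
    by (auto simp: rD(1,4-8) cl dual_bimodule_simps transpose_map_def fun_eq_iff restrict_def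
        extensional_def)
qed

text \<open>
  An isomorphism makes each side a retract of the other.  Moving a retract along isometric
  isomorphisms is therefore composition of retracts.
\<close>

lemma isometric_bimodules_retracts:
  assumes X: "normed_bimodule C X" and XY: "isometric_bimodules C X Y"
  obtains \<phi> \<psi> where "equivariant_retract C C id X Y \<phi> \<psi>" "equivariant_retract C C id Y X \<psi> \<phi>"
proof -
  interpret X: normed_bimodule C X by (rule X)
  obtain \<phi> where iso: "isometric_bimodule_iso C X Y \<phi>"
    using XY unfolding isometric_bimodules_def by blast
  note i = isometric_bimodule_isoD[OF iso]
  define \<psi> where "\<psi> = inv_into (carrier X) \<phi>"
  have \<psi>: "\<psi> (\<phi> x) = x" if "x \<in> carrier X" for x
    using i(1) that unfolding \<psi>_def bij_betw_def by simp
  have ex: "\<exists>x\<in>carrier X. y = \<phi> x" if "y \<in> carrier Y" for y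
    using that i(1) unfolding bij_betw_def by blast
  have \<phi>_lin: "bounded_linear_map X Y \<phi>"
    by (rule bounded_linear_mapI[where K = 1]) (simp_all add: i)
  have \<psi>_lin: "bounded_linear_map Y X \<psi>"
    by (rule bounded_linear_mapI[where K = 1])
      (auto dest!: ex simp: i(4,5,6)[symmetric] \<psi> X.smult_in)
  have "equivariant_retract C C id X Y \<phi> \<psi>"
    unfolding equivariant_retract_def using \<phi>_lin \<psi>_lin
    by (auto dest!: ex simp: i(7,8)[symmetric] \<psi> X.lact_closed X.ract_closed)
  moreover have "equivariant_retract C C id Y X \<psi> \<phi>"
    unfolding equivariant_retract_def using \<phi>_lin \<psi>_lin
    by (auto dest!: ex simp: i(7,8)[symmetric] \<psi> X.lact_closed X.ract_closed)
  ultimately show thesis by (rule that)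
qed


section \<open>Decompositions into two retracts\<close>

text \<open>
  This says that \<open>U\<close> is the direct sum of \<open>X\<close> and \<open>Y\<close>: that the cross terms \<open>q \<circ> i\<close> and \<open>p \<circ> j\<close> vanish
  is a consequence, see \<open>complementary_projection_vanishes\<close>.

  For \<open>U\<close>, \<open>X\<close>, \<open>Y\<close> the algebras \<open>C\<close>, \<open>A\<close>, \<open>B\<close> themselves, with \<open>p = \<pi>\<close> and \<open>q = \<rho>\<close>, equivariance
  of the projections is multiplicativity of \<open>\<pi>\<close> and \<open>\<rho>\<close>, and the decomposition says that \<open>C\<close> is a
  direct product of the algebras \<open>A\<close> and \<open>B\<close>.
\<close>
definition bimodule_decomposition ::
  "('c, 'm) normed_space_scheme \<Rightarrow> ('a, 'n) normed_space_scheme \<Rightarrow> ('b, 'o) normed_space_scheme \<Rightarrow>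
   ('c \<Rightarrow> 'a) \<Rightarrow> ('c \<Rightarrow> 'b) \<Rightarrow>
   ('c, 'u, 'k) bimodule_scheme \<Rightarrow> ('a, 'x, 'l) bimodule_scheme \<Rightarrow> ('b, 'y, 'h) bimodule_scheme \<Rightarrow>
   ('u \<Rightarrow> 'x) \<Rightarrow> ('x \<Rightarrow> 'u) \<Rightarrow> ('u \<Rightarrow> 'y) \<Rightarrow> ('y \<Rightarrow> 'u) \<Rightarrow> bool"
  where "bimodule_decomposition C A B \<pi> \<rho> U X Y p i q j \<longleftrightarrow>
    equivariant_retract C A \<pi> U X p i \<and> equivariant_retract C B \<rho> U Y q j \<and>
    (\<forall>u\<in>carrier U. i (p u) \<oplus>\<^bsub>U\<^esub> j (q u) = u)"

lemma bimodule_decompositionD: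
  assumes "bimodule_decomposition C A B \<pi> \<rho> U X Y p i q j"
  shows "equivariant_retract C A \<pi> U X p i" and "equivariant_retract C B \<rho> U Y q j"
    and "u \<in> carrier U \<Longrightarrow> i (p u) \<oplus>\<^bsub>U\<^esub> j (q u) = u"
  using assms unfolding bimodule_decomposition_def by auto

text \<open>
  For \<open>u = i x\<close> the decomposition reads \<open>i x + j (q (i x)) = i x\<close>, so \<open>j (q (i x)) = 0\<close>, and \<open>j\<close> is
  injective.
\<close>

lemma complementary_projection_vanishes:
  assumes U: "complex_normed_space U" and Y: "complex_normed_space Y"
    and i: "i \<in> carrier X \<rightarrow> carrier U" and q: "bounded_linear_map U Y q"
    and j: "j \<in> carrier Y \<rightarrow> carrier U"
    and pi: "\<And>x. x \<in> carrier X \<Longrightarrow> p (i x) = x" and qj: "\<And>y. y \<in> carrier Y \<Longrightarrow> q (j y) = y"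
    and sum: "\<And>u. u \<in> carrier U \<Longrightarrow> i (p u) \<oplus>\<^bsub>U\<^esub> j (q u) = u" and x: "x \<in> carrier X"
  shows "q (i x) = \<zero>\<^bsub>Y\<^esub>"
proof -
  interpret U: complex_normed_space U by (rule U)
  have ix: "i x \<in> carrier U" and qix: "q (i x) \<in> carrier Y"
    using i x bounded_linear_mapD(1)[OF q] by auto
  then have jqix: "j (q (i x)) \<in> carrier U" using j by auto
  have "i x \<oplus>\<^bsub>U\<^esub> j (q (i x)) = i x" using sum[OF ix] pi[OF x] by simp
  then have "j (q (i x)) = \<zero>\<^bsub>U\<^esub>" using U.add.l_cancel_one[OF ix jqix] by simp
  then show ?thesis using qj[OF qix] bounded_linear_map_zero[OF q U Y] by simp
qed

lemma (in normed_bimodule) act_on_zero: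
  assumes "c \<in> carrier C" shows "lact X c \<zero> = \<zero>" and "ract X \<zero> c = \<zero>"
  using lact_smult[OF assms zero_closed, of 0] ract_smult[OF assms zero_closed, of 0]
    smult_l_null lact_closed[OF assms] ract_closed[OF assms] by simp_all

lemma (in normed_bimodule) act_of_zero:
  assumes C: "complex_normed_space C" and x: "x \<in> carrier X"
  shows "lact X \<zero>\<^bsub>C\<^esub> x = \<zero>" and "ract X x \<zero>\<^bsub>C\<^esub> = \<zero>"
proof -
  interpret C: complex_normed_space C by (rule C)
  show "lact X \<zero>\<^bsub>C\<^esub> x = \<zero>" "ract X x \<zero>\<^bsub>C\<^esub> = \<zero>"
    using smult_lact[OF C.zero_closed x, of 0] smult_ract[OF C.zero_closed x, of 0]
      C.smult_l_null smult_l_null lact_closed[OF C.zero_closed x] ract_closed[OF C.zero_closed x] x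
    by simp_all
qed

text \<open>
  Equivariance of the injections follows from that of the projections: the elements
  \<open>i (\<pi> c \<cdot> x)\<close> and \<open>c \<cdot> i x\<close> have the same components, namely \<open>\<pi> c \<cdot> x\<close> and \<open>0\<close>.
\<close>

lemma bimodule_decompositionI:
  assumes U: "normed_bimodule C U" and X: "normed_bimodule A X" and Y: "normed_bimodule B Y"
    and \<pi>: "\<pi> \<in> carrier C \<rightarrow> carrier A" and \<rho>: "\<rho> \<in> carrier C \<rightarrow> carrier B"
    and p: "bounded_linear_map U X p" and i: "bounded_linear_map X U i"
    and q: "bounded_linear_map U Y q" and j: "bounded_linear_map Y U j"
    and pi: "\<And>x. x \<in> carrier X \<Longrightarrow> p (i x) = x" and qj: "\<And>y. y \<in> carrier Y \<Longrightarrow> q (j y) = y"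
    and sum: "\<And>u. u \<in> carrier U \<Longrightarrow> i (p u) \<oplus>\<^bsub>U\<^esub> j (q u) = u"
    and p_act: "\<And>c u. \<lbrakk>c \<in> carrier C; u \<in> carrier U\<rbrakk>
      \<Longrightarrow> p (lact U c u) = lact X (\<pi> c) (p u) \<and> p (ract U u c) = ract X (p u) (\<pi> c)"
    and q_act: "\<And>c u. \<lbrakk>c \<in> carrier C; u \<in> carrier U\<rbrakk>
      \<Longrightarrow> q (lact U c u) = lact Y (\<rho> c) (q u) \<and> q (ract U u c) = ract Y (q u) (\<rho> c)"
  shows "bimodule_decomposition C A B \<pi> \<rho> U X Y p i q j"
proof -
  interpret U: normed_bimodule C U by (rule U)
  interpret X: normed_bimodule A X by (rule X)
  interpret Y: normed_bimodule B Y by (rule Y)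
  note ns = U.complex_normed_space_axioms X.complex_normed_space_axioms Y.complex_normed_space_axioms
  note pD = bounded_linear_mapD[OF p] and iD = bounded_linear_mapD[OF i]
    and qD = bounded_linear_mapD[OF q] and jD = bounded_linear_mapD[OF j]
  have \<pi>c: "\<pi> c \<in> carrier A" and \<rho>c: "\<rho> c \<in> carrier B" if "c \<in> carrier C" for c
    using that \<pi> \<rho> by auto
  have sum': "j (q u) \<oplus>\<^bsub>U\<^esub> i (p u) = u" if "u \<in> carrier U" for u
    using sum[OF that] U.a_comm[OF iD(1)[OF pD(1)[OF that]] jD(1)[OF qD(1)[OF that]]] by simp
  have iP: "i \<in> carrier X \<rightarrow> carrier U" and jP: "j \<in> carrier Y \<rightarrow> carrier U"
    using iD(1) jD(1) by auto
  have qi: "q (i x) = \<zero>\<^bsub>Y\<^esub>" if "x \<in> carrier X" for x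
    by (rule complementary_projection_vanishes[OF ns(1,3) iP q jP pi qj sum that])
  have pj: "p (j y) = \<zero>\<^bsub>X\<^esub>" if "y \<in> carrier Y" for y
    by (rule complementary_projection_vanishes[OF ns(1,2) jP p iP qj pi sum' that])
  note z = bounded_linear_map_zero[OF i ns(2,1)] bounded_linear_map_zero[OF j ns(3,1)]
  have i_act: "i (lact X (\<pi> c) x) = lact U c (i x)" "i (ract X x (\<pi> c)) = ract U (i x) c"
    if c: "c \<in> carrier C" and x: "x \<in> carrier X" for c x
  proof -
    have ix: "i x \<in> carrier U" by (rule iD(1)[OF x])
    note cl = U.lact_closed[OF c ix] U.ract_closed[OF c ix] X.lact_closed[OF \<pi>c[OF c] x]
      X.ract_closed[OF \<pi>c[OF c] x]
    show "i (lact X (\<pi> c) x) = lact U c (i x)"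
      using sum[OF cl(1)] p_act[OF c ix] q_act[OF c ix] pi[OF x] qi[OF x]
        Y.act_on_zero[OF \<rho>c[OF c]] z(2) U.r_zero[OF iD(1)[OF cl(3)]] by simp
    show "i (ract X x (\<pi> c)) = ract U (i x) c"
      using sum[OF cl(2)] p_act[OF c ix] q_act[OF c ix] pi[OF x] qi[OF x]
        Y.act_on_zero[OF \<rho>c[OF c]] z(2) U.r_zero[OF iD(1)[OF cl(4)]] by simp
  qed
  have j_act: "j (lact Y (\<rho> c) y) = lact U c (j y)" "j (ract Y y (\<rho> c)) = ract U (j y) c"
    if c: "c \<in> carrier C" and y: "y \<in> carrier Y" for c y
  proof -
    have jy: "j y \<in> carrier U" by (rule jD(1)[OF y])
    note cl = U.lact_closed[OF c jy] U.ract_closed[OF c jy] Y.lact_closed[OF \<rho>c[OF c] y]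
      Y.ract_closed[OF \<rho>c[OF c] y]
    show "j (lact Y (\<rho> c) y) = lact U c (j y)"
      using sum[OF cl(1)] p_act[OF c jy] q_act[OF c jy] qj[OF y] pj[OF y]
        X.act_on_zero[OF \<pi>c[OF c]] z(1) U.l_zero[OF jD(1)[OF cl(3)]] by simp
    show "j (ract Y y (\<rho> c)) = ract U (j y) c"
      using sum[OF cl(2)] p_act[OF c jy] q_act[OF c jy] qj[OF y] pj[OF y]
        X.act_on_zero[OF \<pi>c[OF c]] z(1) U.l_zero[OF jD(1)[OF cl(4)]] by simp
  qed
  show ?thesis
    unfolding bimodule_decomposition_def equivariant_retract_def
    by (intro conjI ballI) (simp_all add: \<pi> \<rho> p i q j pi qj sum p_act q_act i_act j_act)
qed

lemma bimodule_decomposition_dual: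
  assumes d: "bimodule_decomposition C A B \<pi> \<rho> U X Y p i q j"
    and U: "normed_bimodule C U" and X: "normed_bimodule A X" and Y: "normed_bimodule B Y"
  shows "bimodule_decomposition C A B \<pi> \<rho> (dual_bimodule U) (dual_bimodule X) (dual_bimodule Y)
    (transpose_map X i) (transpose_map U p) (transpose_map Y j) (transpose_map U q)"
proof -
  interpret U: normed_bimodule C U by (rule U)
  note r = bimodule_decompositionD[OF d]
  note rD = equivariant_retractD[OF r(1)] and sD = equivariant_retractD[OF r(2)]
  note cl = bounded_linear_mapD(1)[OF rD(2)] bounded_linear_mapD(1)[OF rD(3)]
    bounded_linear_mapD(1)[OF sD(2)] bounded_linear_mapD(1)[OF sD(3)]
  have "transpose_map U p (transpose_map X i f) \<oplus>\<^bsub>dual_bimodule U\<^esub>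
      transpose_map U q (transpose_map Y j f) = f" if "f \<in> carrier (dual_bimodule U)" for f
  proof -
    from that have f: "f \<in> extensional (carrier U)" "bounded_functional U f"
      by (simp_all add: dual_bimodule_simps)
    show ?thesis
      unfolding dual_bimodule_simps
    proof (rule extensionalityI[OF _ f(1)])
      fix u assume u: "u \<in> carrier U"
      have "f (i (p u)) + f (j (q u)) = f u"
        using U.bounded_functionalD(1)[OF f(2), of "i (p u)" "j (q u)"] r(3)[OF u] u by (simp add: cl)
      then show "(\<lambda>x\<in>carrier U. transpose_map U p (transpose_map X i f) x +
          transpose_map U q (transpose_map Y j f) x) u = f u"
        using u by (simp add: transpose_map_def cl)
    qed simp
  qed
  then show ?thesis
    unfolding bimodule_decomposition_def
    using equivariant_retract_dual[OF r(1) U X] equivariant_retract_dual[OF r(2) U Y] by blast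
qed

lemma bimodule_decomposition_isometric:
  assumes d: "bimodule_decomposition C A B \<pi> \<rho> U X Y p i q j"
    and U: "normed_bimodule C U" and X: "normed_bimodule A X" and Y: "normed_bimodule B Y"
    and U': "normed_bimodule C U'" and X': "normed_bimodule A X'" and Y': "normed_bimodule B Y'"
    and UU: "isometric_bimodules C U U'" and XX: "isometric_bimodules A X X'"
    and YY: "isometric_bimodules B Y Y'"
  shows "\<exists>p' i' q' j'. bimodule_decomposition C A B \<pi> \<rho> U' X' Y' p' i' q' j'"
proof -
  obtain f f' where f: "equivariant_retract C C id U U' f f'" "equivariant_retract C C id U' U f' f"
    using isometric_bimodules_retracts[OF U UU] by blast
  obtain g g' where g: "equivariant_retract A A id X X' g g'" "equivariant_retract A A id X' X g' g"
    using isometric_bimodules_retracts[OF X XX] by blast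
  obtain h h' where h: "equivariant_retract B B id Y Y' h h'" "equivariant_retract B B id Y' Y h' h"
    using isometric_bimodules_retracts[OF Y YY] by blast
  note ns = U[THEN normed_bimodule.axioms(1)] X[THEN normed_bimodule.axioms(1)]
    Y[THEN normed_bimodule.axioms(1)] U'[THEN normed_bimodule.axioms(1)]
    X'[THEN normed_bimodule.axioms(1)] Y'[THEN normed_bimodule.axioms(1)]
  note r = bimodule_decompositionD[OF d]
  have r1: "equivariant_retract C A \<pi> U' X' (g \<circ> (p \<circ> f')) (f \<circ> i \<circ> g')"
    using equivariant_retract_comp[OF equivariant_retract_comp[OF f(2) r(1) ns(4,1,2)] g(1) ns(4,2,5)]
    by simp
  have r2: "equivariant_retract C B \<rho> U' Y' (h \<circ> (q \<circ> f')) (f \<circ> j \<circ> h')"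
    using equivariant_retract_comp[OF equivariant_retract_comp[OF f(2) r(2) ns(4,1,3)] h(1) ns(4,3,6)]
    by simp
  have "(f \<circ> i \<circ> g') ((g \<circ> (p \<circ> f')) u) \<oplus>\<^bsub>U'\<^esub> (f \<circ> j \<circ> h') ((h \<circ> (q \<circ> f')) u) = u"
    if u: "u \<in> carrier U'" for u
  proof -
    have f'u: "f' u \<in> carrier U"
      using bounded_linear_mapD(1)[OF equivariant_retractD(2)[OF f(2)] u] .
    have pu: "p (f' u) \<in> carrier X" and qu: "q (f' u) \<in> carrier Y"
      using bounded_linear_mapD(1)[OF equivariant_retractD(2)[OF r(1)] f'u]
        bounded_linear_mapD(1)[OF equivariant_retractD(2)[OF r(2)] f'u] .
    have "f (i (p (f' u))) \<oplus>\<^bsub>U'\<^esub> f (j (q (f' u))) = f (f' u)"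
      using bounded_linear_mapD(2)[OF equivariant_retractD(2)[OF f(1)],
          of "i (p (f' u))" "j (q (f' u))"] r(3)[OF f'u]
        bounded_linear_mapD(1)[OF equivariant_retractD(3)[OF r(1)] pu]
        bounded_linear_mapD(1)[OF equivariant_retractD(3)[OF r(2)] qu] by simp
    then show ?thesis
      using equivariant_retractD(4)[OF g(2) pu] equivariant_retractD(4)[OF h(2) qu]
        equivariant_retractD(4)[OF f(1) u] by simp
  qed
  with r1 r2 show ?thesis unfolding bimodule_decomposition_def by blast
qed

lemma dual_tower_decomposition:
  assumes C: "normed_bimodule C (self_bimodule C)" and A: "normed_bimodule A (self_bimodule A)"
    and B: "normed_bimodule B (self_bimodule B)"
    and U: "dual_tower C n U" and S: "dual_tower A n S" and T: "dual_tower B n T"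
    and d: "bimodule_decomposition C A B \<pi> \<rho>
      (self_bimodule C) (self_bimodule A) (self_bimodule B) \<pi> \<iota> \<rho> \<kappa>"
  shows "k \<le> n \<Longrightarrow> \<exists>p i q j. bimodule_decomposition C A B \<pi> \<rho> (U k) (S k) (T k) p i q j"
proof -
  note nU = dual_tower_normed_bimodule[OF C U] and nS = dual_tower_normed_bimodule[OF A S]
    and nT = dual_tower_normed_bimodule[OF B T]
  show "\<exists>p i q j. bimodule_decomposition C A B \<pi> \<rho> (U k) (S k) (T k) p i q j" if "k \<le> n"
    using that
  proof (induction k)
    case 0
    show ?case
      using bimodule_decomposition_isometric[OF d C A B nU nS nT] U S T
      unfolding dual_tower_def by blast
  next
    case (Suc k)
    then have k: "k \<le> n" "k < n" by simp_all
    obtain p i q j where d: "bimodule_decomposition C A B \<pi> \<rho> (U k) (S k) (T k) p i q j"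
      using Suc.IH[OF k(1)] by blast
    note dd = bimodule_decomposition_dual[OF d nU nS nT, OF k(1) k(1) k(1)]
    show ?case
      by (rule bimodule_decomposition_isometric[OF dd
          nU[OF k(1), THEN normed_bimodule.normed_bimodule_dual]
          nS[OF k(1), THEN normed_bimodule.normed_bimodule_dual]
          nT[OF k(1), THEN normed_bimodule.normed_bimodule_dual]
          nU[OF Suc.prems] nS[OF Suc.prems] nT[OF Suc.prems]])
        (use U S T k(2) in \<open>unfold dual_tower_def, blast+\<close>)
  qed
qed


section \<open>Weak amenability of retracts and of direct sums\<close>

lemma self_bimodule_simps [simp]:
  "carrier (self_bimodule C) = carrier C"
  "\<zero>\<^bsub>self_bimodule C\<^esub> = \<zero>\<^bsub>C\<^esub>"
  "add (self_bimodule C) = add C"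
  "smult (self_bimodule C) = smult C"
  "nrm (self_bimodule C) = nrm C"
  "lact (self_bimodule C) = mult C"
  "ract (self_bimodule C) = mult C"
  by (simp_all add: self_bimodule_def)

lemma bounded_linear_map_self_bimodule [simp]:
  "bounded_linear_map (self_bimodule C) X = bounded_linear_map C X"
  "bounded_linear_map X (self_bimodule C) = bounded_linear_map X C"
  by (simp_all add: bounded_linear_map_def fun_eq_iff)

lemma complex_normed_space_of_self_bimodule:
  assumes "normed_bimodule C (self_bimodule C)"
  shows "complex_normed_space C"
proof -
  interpret S: normed_bimodule C "self_bimodule C" by (rule assms)
  have grp: "abelian_group C"
  proof (rule abelian_groupI, goal_cases)
    case (6 x)
    then show ?case using S.l_neg[of x] S.a_inv_closed[of x] by auto
  qed (use S.a_closed S.zero_closed S.a_assoc S.a_comm S.l_zero in simp_all)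
  have "Module.module complex_field C"
    by (rule moduleI[OF cring_complex_field grp])
      (use S.smult_closed S.smult_l_distr S.smult_r_distr S.smult_assoc1 S.one_smult in simp_all)
  then show ?thesis
    by (intro complex_normed_space.intro complex_normed_space_axioms.intro)
      (use S.nrm_nonneg S.nrm_eq_0_iff S.nrm_smult S.nrm_triangle in simp_all)
qed

lemma derivation_iff:
  "derivation C X D \<longleftrightarrow> bounded_linear_map C X D \<and>
    (\<forall>c\<in>carrier C. \<forall>d\<in>carrier C. D (c \<otimes>\<^bsub>C\<^esub> d) = ract X (D c) d \<oplus>\<^bsub>X\<^esub> lact X c (D d))"
  unfolding derivation_def bounded_linear_map_def by blast

text \<open>
  For the algebras as bimodules over themselves, equivariance of \<open>\<pi>\<close> is multiplicativity, and
  multiplicativity of \<open>\<iota>\<close> is its equivariance at elements \<open>c = \<iota> a\<close>.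
\<close>

lemma retract_of_self_section:
  assumes "equivariant_retract C A \<pi> (self_bimodule C) (self_bimodule A) \<pi> \<iota>"
  shows "bounded_linear_map C A \<pi>" and "bounded_linear_map A C \<iota>"
    and "a \<in> carrier A \<Longrightarrow> \<pi> (\<iota> a) = a"
    and "\<lbrakk>c \<in> carrier C; d \<in> carrier C\<rbrakk> \<Longrightarrow> \<pi> (c \<otimes>\<^bsub>C\<^esub> d) = \<pi> c \<otimes>\<^bsub>A\<^esub> \<pi> d"
    and "\<lbrakk>a \<in> carrier A; b \<in> carrier A\<rbrakk> \<Longrightarrow> \<iota> (a \<otimes>\<^bsub>A\<^esub> b) = \<iota> a \<otimes>\<^bsub>C\<^esub> \<iota> b"
proof -
  note rD = equivariant_retractD[OF assms, simplified]
  show "bounded_linear_map C A \<pi>" "bounded_linear_map A C \<iota>" by (rule rD(2,3))+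
  show pi: "\<pi> (\<iota> a) = a" if "a \<in> carrier A" for a by (rule rD(4)[OF that])
  show "\<pi> (c \<otimes>\<^bsub>C\<^esub> d) = \<pi> c \<otimes>\<^bsub>A\<^esub> \<pi> d" if "c \<in> carrier C" "d \<in> carrier C"
    using rD(5) that by blast
  show "\<iota> (a \<otimes>\<^bsub>A\<^esub> b) = \<iota> a \<otimes>\<^bsub>C\<^esub> \<iota> b" if "a \<in> carrier A" "b \<in> carrier A"
    using rD(7)[of "\<iota> a" b] bounded_linear_mapD(1)[OF rD(3)] pi that by simp
qed

lemma derivation_compress:
  assumes a: "equivariant_retract C A \<pi> (self_bimodule C) (self_bimodule A) \<pi> \<iota>"
    and r: "equivariant_retract C A \<pi> U X p i"
    and C: "normed_bimodule C (self_bimodule C)" and A: "normed_bimodule A (self_bimodule A)"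
    and U: "normed_bimodule C U" and D: "derivation C U D"
  shows "derivation A X (p \<circ> D \<circ> \<iota>)"
proof -
  interpret U: normed_bimodule C U by (rule U)
  note nC = complex_normed_space_of_self_bimodule[OF C]
    and nA = complex_normed_space_of_self_bimodule[OF A]
  note rD = equivariant_retractD[OF r] and h = retract_of_self_section[OF a]
  have Dl: "bounded_linear_map C U D" and Dm: "\<And>c d. \<lbrakk>c \<in> carrier C; d \<in> carrier C\<rbrakk>
      \<Longrightarrow> D (c \<otimes>\<^bsub>C\<^esub> d) = ract U (D c) d \<oplus>\<^bsub>U\<^esub> lact U c (D d)"
    using D unfolding derivation_iff by blast+
  note cl = bounded_linear_mapD(1)[OF h(2)] bounded_linear_mapD(1)[OF Dl] U.lact_closed U.ract_closed
  show ?thesis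
    unfolding derivation_iff
  proof (intro conjI ballI)
    show "bounded_linear_map A X (p \<circ> D \<circ> \<iota>)"
      by (intro bounded_linear_map_comp[OF h(2)] bounded_linear_map_comp[OF Dl rD(2)]
          nA nC U.complex_normed_space_axioms)
    fix a b assume "a \<in> carrier A" "b \<in> carrier A"
    then show "(p \<circ> D \<circ> \<iota>) (a \<otimes>\<^bsub>A\<^esub> b) =
        ract X ((p \<circ> D \<circ> \<iota>) a) b \<oplus>\<^bsub>X\<^esub> lact X a ((p \<circ> D \<circ> \<iota>) b)"
      by (simp add: h(3,5) Dm cl bounded_linear_mapD(2)[OF rD(2)] rD(5,6))
  qed
qed

lemma derivation_inflate:
  assumes a: "equivariant_retract C A \<pi> (self_bimodule C) (self_bimodule A) \<pi> \<iota>"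
    and r: "equivariant_retract C A \<pi> U X p i"
    and C: "normed_bimodule C (self_bimodule C)" and A: "normed_bimodule A (self_bimodule A)"
    and X: "normed_bimodule A X" and D: "derivation A X D"
  shows "derivation C U (i \<circ> D \<circ> \<pi>)"
proof -
  interpret X: normed_bimodule A X by (rule X)
  note nC = complex_normed_space_of_self_bimodule[OF C]
    and nA = complex_normed_space_of_self_bimodule[OF A]
  note rD = equivariant_retractD[OF r] and h = retract_of_self_section[OF a]
  have Dl: "bounded_linear_map A X D" and Dm: "\<And>c d. \<lbrakk>c \<in> carrier A; d \<in> carrier A\<rbrakk>
      \<Longrightarrow> D (c \<otimes>\<^bsub>A\<^esub> d) = ract X (D c) d \<oplus>\<^bsub>X\<^esub> lact X c (D d)"
    using D unfolding derivation_iff by blast+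
  note cl = bounded_linear_mapD(1)[OF h(1)] bounded_linear_mapD(1)[OF Dl] X.lact_closed X.ract_closed
  show ?thesis
    unfolding derivation_iff
  proof (intro conjI ballI)
    show "bounded_linear_map C U (i \<circ> D \<circ> \<pi>)"
      by (intro bounded_linear_map_comp[OF h(1)] bounded_linear_map_comp[OF Dl rD(3)]
          nA nC X.complex_normed_space_axioms)
    fix c d assume "c \<in> carrier C" "d \<in> carrier C"
    then show "(i \<circ> D \<circ> \<pi>) (c \<otimes>\<^bsub>C\<^esub> d) =
        ract U ((i \<circ> D \<circ> \<pi>) c) d \<oplus>\<^bsub>U\<^esub> lact U c ((i \<circ> D \<circ> \<pi>) d)"
      by (simp add: h(4) Dm cl bounded_linear_mapD(2)[OF rD(3)] rD(7,8))
  qed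
qed

text \<open>
  A derivation \<open>D\<close> of \<open>A\<close> is recovered from the derivation \<open>i \<circ> D \<circ> \<pi>\<close> of \<open>C\<close> by applying \<open>p\<close> and
  restricting along \<open>\<iota>\<close>.  If \<open>u\<close> implements \<open>i \<circ> D \<circ> \<pi>\<close>, then \<open>p u\<close> implements \<open>D\<close>.
\<close>

lemma inner_derivations_retract:
  assumes a: "equivariant_retract C A \<pi> (self_bimodule C) (self_bimodule A) \<pi> \<iota>"
    and r: "equivariant_retract C A \<pi> U X p i"
    and C: "normed_bimodule C (self_bimodule C)" and A: "normed_bimodule A (self_bimodule A)"
    and U: "normed_bimodule C U" and X: "normed_bimodule A X"
    and inner: "\<And>D. derivation C U D \<Longrightarrow> inner_derivation C U D"
    and D: "derivation A X D"
  shows "inner_derivation A X D"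
proof -
  interpret U: normed_bimodule C U by (rule U)
  interpret X: normed_bimodule A X by (rule X)
  note rD = equivariant_retractD[OF r] and h = retract_of_self_section[OF a]
  obtain u where u: "u \<in> carrier U"
    and E: "\<And>c. c \<in> carrier C \<Longrightarrow> (i \<circ> D \<circ> \<pi>) c = lact U c u \<ominus>\<^bsub>U\<^esub> ract U u c"
    using inner[OF derivation_inflate[OF a r C A X D]] unfolding inner_derivation_def by blast
  have "D b = lact X b (p u) \<ominus>\<^bsub>X\<^esub> ract X (p u) b" if b: "b \<in> carrier A" for b
  proof -
    have \<iota>b: "\<iota> b \<in> carrier C" by (rule bounded_linear_mapD(1)[OF h(2) b])
    have Db: "D b \<in> carrier X" using D b unfolding derivation_def by blast
    have "D b = p (lact U (\<iota> b) u \<ominus>\<^bsub>U\<^esub> ract U u (\<iota> b))"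
      using E[OF \<iota>b] h(3)[OF b] rD(4)[OF Db] by simp
    also have "\<dots> = p (lact U (\<iota> b) u) \<ominus>\<^bsub>X\<^esub> p (ract U u (\<iota> b))"
      by (rule bounded_linear_map_diff[OF rD(2) U.complex_normed_space_axioms
          X.complex_normed_space_axioms U.lact_closed[OF \<iota>b u] U.ract_closed[OF \<iota>b u]])
    finally show ?thesis by (simp add: rD(5,6) \<iota>b u h(3)[OF b])
  qed
  then show ?thesis
    unfolding inner_derivation_def using bounded_linear_mapD(1)[OF rD(2) u] by blast
qed

text \<open>
  The unit of \<open>A\<close> acts as the identity on every iterated dual of \<open>A\<close>.  This is where the unit
  enters the description of derivations into the \<open>n\<close>-th dual.
\<close>
definition acts_as_identity :: "'c \<Rightarrow> ('c, 'x, 'n) bimodule_scheme \<Rightarrow> bool"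
  where "acts_as_identity e X \<longleftrightarrow> (\<forall>x\<in>carrier X. lact X e x = x \<and> ract X x e = x)"

lemma acts_as_identity_dual:
  "acts_as_identity e X \<Longrightarrow> acts_as_identity e (dual_bimodule X)"
  by (auto simp: acts_as_identity_def dual_bimodule_simps fun_eq_iff restrict_def extensional_def)

lemma acts_as_identity_isometric:
  assumes "acts_as_identity e X" "isometric_bimodules C X Y" "e \<in> carrier C"
  shows "acts_as_identity e Y"
proof -
  obtain \<phi> where iso: "isometric_bimodule_iso C X Y \<phi>"
    using assms unfolding isometric_bimodules_def by blast
  note i = isometric_bimodule_isoD[OF iso]
  have ex: "\<exists>x\<in>carrier X. y = \<phi> x" if "y \<in> carrier Y" for y
    using that i(1) unfolding bij_betw_def by blast
  show ?thesis
    using assms(1,3) unfolding acts_as_identity_def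
    by (auto dest!: ex simp: i(7,8)[symmetric])
qed

lemma acts_as_identity_dual_tower:
  assumes T: "dual_tower C n T" and e: "e \<in> carrier C" "acts_as_identity e (self_bimodule C)"
  shows "k \<le> n \<Longrightarrow> acts_as_identity e (T k)"
proof (induction k)
  case 0
  show ?case
    using acts_as_identity_isometric[OF e(2) _ e(1)] T unfolding dual_tower_def by blast
next
  case (Suc k)
  then have "isometric_bimodules C (dual_bimodule (T k)) (T (Suc k))" "acts_as_identity e (T k)"
    using T unfolding dual_tower_def by auto
  then show ?case
    using acts_as_identity_isometric[OF acts_as_identity_dual _ e(1)] by blast
qed

text \<open>
  Write \<open>\<epsilon> = \<iota> e\<close>.  The mixed components of \<open>D\<close> vanish for two different reasons.  On the image of \<open>A\<close>,
  expanding \<open>D (a \<epsilon>)\<close> expresses \<open>D a\<close> by the actions of \<open>a\<close> and \<open>\<epsilon>\<close>, and both act as zero on \<open>Y\<close>.  On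
  the image of \<open>B\<close>, the product \<open>b \<epsilon>\<close> is zero, and in \<open>X\<close> the expansion of \<open>0 = D (b \<epsilon>)\<close> leaves just
  the component of \<open>D b\<close>, because \<open>\<epsilon>\<close> acts as the identity on \<open>X\<close> and \<open>b\<close> as zero.  The sum of
  elements implementing the two remaining components implements \<open>D\<close>.
\<close>

lemma inner_derivations_direct_sum:
  assumes a: "bimodule_decomposition C A B \<pi> \<rho>
      (self_bimodule C) (self_bimodule A) (self_bimodule B) \<pi> \<iota> \<rho> \<kappa>"
    and d: "bimodule_decomposition C A B \<pi> \<rho> U X Y p i q j"
    and C: "normed_bimodule C (self_bimodule C)" and A: "normed_bimodule A (self_bimodule A)"
    and B: "normed_bimodule B (self_bimodule B)"
    and U: "normed_bimodule C U" and X: "normed_bimodule A X" and Y: "normed_bimodule B Y"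
    and e: "e \<in> carrier A" "acts_as_identity e (self_bimodule A)" "acts_as_identity e X"
    and innerA: "\<And>D. derivation A X D \<Longrightarrow> inner_derivation A X D"
    and innerB: "\<And>D. derivation B Y D \<Longrightarrow> inner_derivation B Y D"
    and D: "derivation C U D"
  shows "inner_derivation C U D"
proof -
  interpret U: normed_bimodule C U by (rule U)
  interpret X: normed_bimodule A X by (rule X)
  interpret Y: normed_bimodule B Y by (rule Y)
  note nC = complex_normed_space_of_self_bimodule[OF C]
    and nA = complex_normed_space_of_self_bimodule[OF A]
    and nB = complex_normed_space_of_self_bimodule[OF B]
  note ns = U.complex_normed_space_axioms X.complex_normed_space_axioms Y.complex_normed_space_axioms
  interpret C: complex_normed_space C by (rule nC)
  note ad = bimodule_decompositionD[OF a] and dd = bimodule_decompositionD[OF d]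
  note g = retract_of_self_section[OF ad(1)] and h = retract_of_self_section[OF ad(2)]
  note rD = equivariant_retractD[OF dd(1)] and sD = equivariant_retractD[OF dd(2)]
  have Dl: "bounded_linear_map C U D" and Dm: "\<And>c d. \<lbrakk>c \<in> carrier C; d \<in> carrier C\<rbrakk>
      \<Longrightarrow> D (c \<otimes>\<^bsub>C\<^esub> d) = ract U (D c) d \<oplus>\<^bsub>U\<^esub> lact U c (D d)"
    using D unfolding derivation_iff by blast+
  note cl = bounded_linear_mapD(1)[OF g(1)] bounded_linear_mapD(1)[OF g(2)]
    bounded_linear_mapD(1)[OF h(1)] bounded_linear_mapD(1)[OF h(2)] bounded_linear_mapD(1)[OF Dl]
    bounded_linear_mapD(1)[OF rD(2)] bounded_linear_mapD(1)[OF rD(3)]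
    bounded_linear_mapD(1)[OF sD(2)] bounded_linear_mapD(1)[OF sD(3)]
    U.lact_closed U.ract_closed X.lact_closed X.ract_closed Y.lact_closed Y.ract_closed
  have sumC: "\<iota> (\<pi> c) \<oplus>\<^bsub>C\<^esub> \<kappa> (\<rho> c) = c" "\<kappa> (\<rho> c) \<oplus>\<^bsub>C\<^esub> \<iota> (\<pi> c) = c"
    if "c \<in> carrier C" for c
    using ad(3)[of c] that C.a_comm[of "\<iota> (\<pi> c)" "\<kappa> (\<rho> c)"] cl(1-4) by simp_all
  have \<iota>P: "\<iota> \<in> carrier A \<rightarrow> carrier C" and \<kappa>P: "\<kappa> \<in> carrier B \<rightarrow> carrier C"
    using cl(2,4) by auto
  have \<rho>\<iota>: "\<rho> (\<iota> x) = \<zero>\<^bsub>B\<^esub>" if "x \<in> carrier A" for x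
    by (rule complementary_projection_vanishes[OF nC nB \<iota>P h(1) \<kappa>P g(3) h(3) sumC(1) that])
  have \<pi>\<kappa>: "\<pi> (\<kappa> y) = \<zero>\<^bsub>A\<^esub>" if "y \<in> carrier B" for y
    by (rule complementary_projection_vanishes[OF nC nA \<kappa>P g(1) \<iota>P h(3) g(3) sumC(2) that])
  have mult_closed: "c \<otimes>\<^bsub>C\<^esub> d \<in> carrier C" if "c \<in> carrier C" "d \<in> carrier C" for c d
    using self_bimodule_closed(3)[OF C that] .
  have eA: "x \<otimes>\<^bsub>A\<^esub> e = x" if "x \<in> carrier A" for x
    using e(2) that by (simp add: acts_as_identity_def)
  have eX: "ract X x e = x" if "x \<in> carrier X" for x
    using e(3) that by (simp add: acts_as_identity_def)
  have \<epsilon>: "\<iota> e \<in> carrier C" "D (\<iota> e) \<in> carrier U" using cl e(1) by auto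
  have qD\<iota>: "q (D (\<iota> x)) = \<zero>\<^bsub>Y\<^esub>" if x: "x \<in> carrier A" for x
  proof -
    have "q (D (\<iota> x)) = q (D (\<iota> x \<otimes>\<^bsub>C\<^esub> \<iota> e))"
      using g(5)[OF x e(1)] eA[OF x] by simp
    also have "\<dots> = ract Y (q (D (\<iota> x))) \<zero>\<^bsub>B\<^esub> \<oplus>\<^bsub>Y\<^esub> lact Y \<zero>\<^bsub>B\<^esub> (q (D (\<iota> e)))"
      using x e(1) by (simp add: Dm cl bounded_linear_mapD(2)[OF sD(2)] sD(5,6) \<rho>\<iota>)
    also have "\<dots> = \<zero>\<^bsub>Y\<^esub>"
      using x e(1) by (simp add: Y.act_of_zero[OF nB] cl)
    finally show ?thesis .
  qed
  have pD\<kappa>: "p (D (\<kappa> y)) = \<zero>\<^bsub>X\<^esub>" if y: "y \<in> carrier B" for y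
  proof -
    interpret A: normed_bimodule A "self_bimodule A" by (rule A)
    interpret B: normed_bimodule B "self_bimodule B" by (rule B)
    let ?z = "\<kappa> y \<otimes>\<^bsub>C\<^esub> \<iota> e"
    have z: "?z \<in> carrier C" using y e(1) by (simp add: mult_closed cl)
    have "\<pi> ?z = \<zero>\<^bsub>A\<^esub>" "\<rho> ?z = \<zero>\<^bsub>B\<^esub>"
      using y e(1) A.act_of_zero(1)[OF nA, of e] B.act_of_zero(2)[OF nB, of y]
      by (simp_all add: g(3,4) h(3,4) cl \<pi>\<kappa> \<rho>\<iota>)
    \<comment> \<open>An element of \<open>C\<close> is determined by its two components.\<close>
    then have "?z = \<zero>\<^bsub>C\<^esub>"
      using sumC(1)[OF z] bounded_linear_map_zero[OF g(2) nA nC]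
        bounded_linear_map_zero[OF h(2) nB nC] by simp
    then have "p (D ?z) = \<zero>\<^bsub>X\<^esub>"
      using bounded_linear_map_zero[OF Dl nC ns(1)] bounded_linear_map_zero[OF rD(2) ns(1,2)] by simp
    moreover have "p (D ?z) = ract X (p (D (\<kappa> y))) e \<oplus>\<^bsub>X\<^esub> lact X \<zero>\<^bsub>A\<^esub> (p (D (\<iota> e)))"
      using y e(1) by (simp add: Dm cl bounded_linear_mapD(2)[OF rD(2)] rD(5,6) \<pi>\<kappa> g(3))
    ultimately show ?thesis
      using y e(1) by (simp add: X.act_of_zero[OF nA] cl eX)
  qed
  obtain x where x: "x \<in> carrier X"
    and Dx: "\<And>b. b \<in> carrier A \<Longrightarrow> (p \<circ> D \<circ> \<iota>) b = lact X b x \<ominus>\<^bsub>X\<^esub> ract X x b"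
    using innerA[OF derivation_compress[OF ad(1) dd(1) C A U D]]
    unfolding inner_derivation_def by blast
  obtain y where y: "y \<in> carrier Y"
    and Dy: "\<And>b. b \<in> carrier B \<Longrightarrow> (q \<circ> D \<circ> \<kappa>) b = lact Y b y \<ominus>\<^bsub>Y\<^esub> ract Y y b"
    using innerB[OF derivation_compress[OF ad(2) dd(2) C B U D]]
    unfolding inner_derivation_def by blast
  let ?u = "i x \<oplus>\<^bsub>U\<^esub> j y"
  have ix: "i x \<in> carrier U" and jy: "j y \<in> carrier U" using x y cl by auto
  have "D c = lact U c ?u \<ominus>\<^bsub>U\<^esub> ract U ?u c" if c: "c \<in> carrier C" for c
  proof -
    have Dc: "D c = D (\<iota> (\<pi> c)) \<oplus>\<^bsub>U\<^esub> D (\<kappa> (\<rho> c))"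
      using bounded_linear_mapD(2)[OF Dl, of "\<iota> (\<pi> c)" "\<kappa> (\<rho> c)"] sumC(1)[OF c] c cl by simp
    have "p (D c) = lact X (\<pi> c) x \<ominus>\<^bsub>X\<^esub> ract X x (\<pi> c)"
      using Dx[of "\<pi> c"] c by (simp add: Dc bounded_linear_mapD(2)[OF rD(2)] cl pD\<kappa> x)
    then have ip: "i (p (D c)) = lact U c (i x) \<ominus>\<^bsub>U\<^esub> ract U (i x) c"
      using c x by (simp add: bounded_linear_map_diff[OF rD(3) ns(2,1)] cl rD(7,8))
    have "q (D c) = lact Y (\<rho> c) y \<ominus>\<^bsub>Y\<^esub> ract Y y (\<rho> c)"
      using Dy[of "\<rho> c"] c by (simp add: Dc bounded_linear_mapD(2)[OF sD(2)] cl qD\<iota> y)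
    then have jq: "j (q (D c)) = lact U c (j y) \<ominus>\<^bsub>U\<^esub> ract U (j y) c"
      using c y by (simp add: bounded_linear_map_diff[OF sD(3) ns(3,1)] cl sD(7,8))
    have "D c = (lact U c (i x) \<ominus>\<^bsub>U\<^esub> ract U (i x) c) \<oplus>\<^bsub>U\<^esub> (lact U c (j y) \<ominus>\<^bsub>U\<^esub> ract U (j y) c)"
      using dd(3)[of "D c"] c cl unfolding ip jq by simp
    then show ?thesis
      using c ix jy cl
      by (simp add: U.lact_add U.ract_add a_minus_def U.minus_add U.a_ac)
  qed
  then show ?thesis
    unfolding inner_derivation_def using ix jy by blast
qed

theorem n_weakly_amenable_direct_sum:
  assumes C: "normed_bimodule C (self_bimodule C)" and A: "normed_bimodule A (self_bimodule A)"
    and B: "normed_bimodule B (self_bimodule B)" and unital: "unital A"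
    and d: "bimodule_decomposition C A B \<pi> \<rho>
      (self_bimodule C) (self_bimodule A) (self_bimodule B) \<pi> \<iota> \<rho> \<kappa>"
    and S: "dual_tower A n S" and T: "dual_tower B n T" and U: "dual_tower C n U"
  shows "n_weakly_amenable n C U \<longleftrightarrow> n_weakly_amenable n A S \<and> n_weakly_amenable n B T"
proof -
  note nU = dual_tower_normed_bimodule[OF C U order_refl]
    and nS = dual_tower_normed_bimodule[OF A S order_refl]
    and nT = dual_tower_normed_bimodule[OF B T order_refl]
  obtain e where e: "e \<in> carrier A" "acts_as_identity e (self_bimodule A)"
    using unital by (auto simp: unital_def acts_as_identity_def)
  obtain p i q j where dn: "bimodule_decomposition C A B \<pi> \<rho> (U n) (S n) (T n) p i q j"
    using dual_tower_decomposition[OF C A B U S T d order_refl] by blast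
  note ad = bimodule_decompositionD[OF d] and dd = bimodule_decompositionD[OF dn]
  show ?thesis
    unfolding n_weakly_amenable_def
    using inner_derivations_retract[OF ad(1) dd(1) C A nU nS]
      inner_derivations_retract[OF ad(2) dd(2) C B nU nT]
      inner_derivations_direct_sum[OF d dn C A B nU nS nT e
        acts_as_identity_dual_tower[OF S e order_refl]]
    by blast
qed


section \<open>The amalgamated duplication of a unital algebra\<close>

text \<open>
  Here \<open>\<pi>\<close> and \<open>snd\<close> are the components of the isomorphism \<open>(a, \<beta>) \<mapsto> (a + \<psi> \<beta>, \<beta>)\<close>, where
  \<open>\<psi> \<beta> = \<beta> \<cdot> e\<close>, and \<open>\<iota>\<close> and \<open>\<kappa>\<close> are the restrictions of its inverse \<open>(a, \<beta>) \<mapsto> (a - \<psi> \<beta>, \<beta>)\<close> to the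
  two factors.
\<close>

lemma amalgamated_duplication_decomposition:
  fixes A :: "'a normed_space" and B :: "'b normed_space"
  assumes A: "banach_algebra A" and B: "banach_algebra B"
    and M: "banach_bimodule B (with_actions A l r)" and comp: "compatible_actions A B l r"
    and e: "e \<in> carrier A" "\<And>a. a \<in> carrier A \<Longrightarrow> e \<otimes>\<^bsub>A\<^esub> a = a"
      "\<And>a. a \<in> carrier A \<Longrightarrow> a \<otimes>\<^bsub>A\<^esub> e = a"
  defines "P \<equiv> amalgamated_duplication A B l r"
    and "\<pi> \<equiv> \<lambda>(a, \<beta>). a \<oplus>\<^bsub>A\<^esub> l \<beta> e" and "\<iota> \<equiv> \<lambda>a. (a, \<zero>\<^bsub>B\<^esub>)" and "\<kappa> \<equiv> \<lambda>\<beta>. (\<ominus>\<^bsub>A\<^esub> l \<beta> e, \<beta>)"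
  shows "bimodule_decomposition P A B \<pi> snd
    (self_bimodule P) (self_bimodule A) (self_bimodule B) \<pi> \<iota> snd \<kappa>"
proof -
  interpret A: banach_algebra A by (rule A)
  interpret B: banach_algebra B by (rule B)
  interpret M: banach_bimodule B "with_actions A l r" by (rule M)
  note act = M.lact_closed[simplified] M.ract_closed[simplified]
  note sm = A.smult_closed[simplified] B.smult_closed[simplified] A.smult_r_distr[simplified]
  have co: "l \<beta> (a \<otimes>\<^bsub>A\<^esub> b) = l \<beta> a \<otimes>\<^bsub>A\<^esub> b"
    "r (a \<otimes>\<^bsub>A\<^esub> b) \<beta> = a \<otimes>\<^bsub>A\<^esub> r b \<beta>" "a \<otimes>\<^bsub>A\<^esub> l \<beta> b = r a \<beta> \<otimes>\<^bsub>A\<^esub> b"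
    if "a \<in> carrier A" "b \<in> carrier A" "\<beta> \<in> carrier B" for a b \<beta>
    using comp that unfolding compatible_actions_def by blast+
  define \<psi> where "\<psi> \<beta> = l \<beta> e" for \<beta>
  have \<psi>: "\<psi> \<beta> \<in> carrier A" if "\<beta> \<in> carrier B" for \<beta>
    using that e(1) by (simp add: \<psi>_def act)
  have l: "l \<beta> a = \<psi> \<beta> \<otimes>\<^bsub>A\<^esub> a" if "a \<in> carrier A" "\<beta> \<in> carrier B" for a \<beta>
    using co(1)[OF e(1) that] that e by (simp add: \<psi>_def)
  \<comment> \<open>Move \<open>\<beta>\<close> from one factor of \<open>e e\<close> to the other.\<close>
  have r_e: "r e \<beta> = \<psi> \<beta>" if "\<beta> \<in> carrier B" for \<beta>
    using co(3)[OF e(1) e(1) that] that e by (simp add: \<psi>_def act)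
  have r: "r a \<beta> = a \<otimes>\<^bsub>A\<^esub> \<psi> \<beta>" if "a \<in> carrier A" "\<beta> \<in> carrier B" for a \<beta>
    using co(2)[OF that(1) e(1) that(2)] that e by (simp add: r_e)
  have \<psi>_add: "\<psi> (\<beta> \<oplus>\<^bsub>B\<^esub> \<gamma>) = \<psi> \<beta> \<oplus>\<^bsub>A\<^esub> \<psi> \<gamma>" if "\<beta> \<in> carrier B" "\<gamma> \<in> carrier B" for \<beta> \<gamma>
    using M.add_lact[simplified] that e(1) by (simp add: \<psi>_def)
  have \<psi>_smult: "\<psi> (k \<odot>\<^bsub>B\<^esub> \<beta>) = k \<odot>\<^bsub>A\<^esub> \<psi> \<beta>" if "\<beta> \<in> carrier B" for k \<beta>
    using M.smult_lact[simplified] that e(1) by (simp add: \<psi>_def)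
  have \<psi>_mult: "\<psi> (\<beta> \<otimes>\<^bsub>B\<^esub> \<gamma>) = \<psi> \<beta> \<otimes>\<^bsub>A\<^esub> \<psi> \<gamma>" if "\<beta> \<in> carrier B" "\<gamma> \<in> carrier B" for \<beta> \<gamma>
    using M.lact_mult[simplified] that e(1) l[of "\<psi> \<gamma>" \<beta>] \<psi> by (simp add: \<psi>_def)
  have "\<exists>K. \<forall>\<beta>\<in>carrier B. nrm A (\<psi> \<beta>) \<le> K * nrm B \<beta>"
  proof -
    obtain K where K: "\<forall>\<beta>\<in>carrier B. \<forall>a\<in>carrier A. nrm A (l \<beta> a) \<le> K * nrm B \<beta> * nrm A a"
      using M.lact_bounded[simplified] by blast
    show ?thesis
      by (intro exI[of _ "K * nrm A e"]) (use K e(1) in \<open>auto simp: \<psi>_def mult_ac\<close>)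
  qed
  then have \<psi>_lin: "bounded_linear_map B A \<psi>"
    unfolding bounded_linear_map_def using \<psi> \<psi>_add \<psi>_smult by blast
  obtain K where K: "0 \<le> K" "\<And>\<beta>. \<beta> \<in> carrier B \<Longrightarrow> nrm A (\<psi> \<beta>) \<le> K * nrm B \<beta>"
    using bounded_linear_map_bound[OF \<psi>_lin B.complex_normed_space_axioms] by blast
  have \<psi>0: "\<psi> \<zero>\<^bsub>B\<^esub> = \<zero>\<^bsub>A\<^esub>"
    by (rule bounded_linear_map_zero[OF \<psi>_lin B.complex_normed_space_axioms A.complex_normed_space_axioms])
  have \<pi>: "\<pi> (a, \<beta>) = a \<oplus>\<^bsub>A\<^esub> \<psi> \<beta>" for a \<beta> by (simp add: \<pi>_def \<psi>_def)
  have \<kappa>: "\<kappa> \<beta> = (\<ominus>\<^bsub>A\<^esub> \<psi> \<beta>, \<beta>)" for \<beta> by (simp add: \<kappa>_def \<psi>_def)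
  have bl_\<pi>: "bounded_linear_map P A \<pi>"
  proof (rule bounded_linear_mapI[where K = "1 + K"])
    fix x assume "x \<in> carrier P"
    then obtain a \<beta> where x: "x = (a, \<beta>)" "a \<in> carrier A" "\<beta> \<in> carrier B" by (auto simp: P_def)
    have "nrm A (a \<oplus>\<^bsub>A\<^esub> \<psi> \<beta>) \<le> nrm A a + K * nrm B \<beta>"
      using A.nrm_triangle[of a "\<psi> \<beta>"] K(2)[of \<beta>] x \<psi> by simp
    also have "\<dots> \<le> (1 + K) * (nrm A a + nrm B \<beta>)"
      using x K(1) A.nrm_nonneg[of a] B.nrm_nonneg[of \<beta>] by (simp add: algebra_simps)
    finally show "nrm A (\<pi> x) \<le> (1 + K) * nrm P x" by (simp add: x P_def \<pi>)
  qed (auto simp: P_def \<pi> \<psi> \<psi>_add \<psi>_smult sm A.a_ac)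
  have bl_\<iota>: "bounded_linear_map A P \<iota>"
  proof (rule bounded_linear_mapI[where K = 1])
    fix x k assume "x \<in> carrier A"
    then show "\<iota> (k \<odot>\<^bsub>A\<^esub> x) = k \<odot>\<^bsub>P\<^esub> \<iota> x"
      using B.smult_r_null[of k] by (simp add: P_def \<iota>_def)
  qed (use B.nrm_eq_0_iff[of "\<zero>\<^bsub>B\<^esub>"] in \<open>auto simp: P_def \<iota>_def\<close>)
  have bl_snd: "bounded_linear_map P B snd"
    by (rule bounded_linear_mapI[where K = 1]) (auto simp: P_def A.nrm_nonneg)
  have bl_\<kappa>: "bounded_linear_map B P \<kappa>"
  proof (rule bounded_linear_mapI[where K = "K + 1"])
    fix x k assume x: "x \<in> carrier B"
    then show "\<kappa> (k \<odot>\<^bsub>B\<^esub> x) = k \<odot>\<^bsub>P\<^esub> \<kappa> x"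
      using A.smult_r_minus[of k "\<psi> x"] \<psi> by (simp add: P_def \<kappa> \<psi>_smult)
    show "nrm P (\<kappa> x) \<le> (K + 1) * nrm B x"
      using K(2)[OF x] A.nrm_minus[OF \<psi>[OF x]] by (simp add: P_def \<kappa> algebra_simps)
  qed (auto simp: P_def \<kappa> \<psi> \<psi>_add A.minus_add)
  have \<pi>_mult: "\<pi> (c \<otimes>\<^bsub>P\<^esub> d) = \<pi> c \<otimes>\<^bsub>A\<^esub> \<pi> d" if "c \<in> carrier P" "d \<in> carrier P" for c d
  proof -
    from that obtain a \<beta> b \<gamma> where "c = (a, \<beta>)" "d = (b, \<gamma>)" "a \<in> carrier A" "\<beta> \<in> carrier B"
      "b \<in> carrier A" "\<gamma> \<in> carrier B" by (auto simp: P_def)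
    then show ?thesis
      by (simp add: P_def \<pi> l r \<psi> \<psi>_mult A.mult_closed A.mult_add_left A.mult_add_right A.a_ac)
  qed
  have snd_mult: "snd (c \<otimes>\<^bsub>P\<^esub> d) = snd c \<otimes>\<^bsub>B\<^esub> snd d" if "c \<in> carrier P" "d \<in> carrier P" for c d
    using that by (auto simp: P_def)
  note nP = normed_bimodule_self_amalgamated_duplication[OF A B M comp, folded P_def]
  show ?thesis
  proof (rule bimodule_decompositionI[OF nP normed_bimodule_self[OF A] normed_bimodule_self[OF B]],
      simp_all add: bl_\<pi> bl_\<iota> bl_snd bl_\<kappa> \<pi>_mult snd_mult)
    show "\<pi> \<in> carrier P \<rightarrow> carrier A" using bl_\<pi> by (simp add: bounded_linear_map_def)
    show "snd \<in> carrier P \<rightarrow> carrier B" by (auto simp: P_def)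
    show "\<pi> (\<iota> x) = x" if "x \<in> carrier A" for x
      using that by (simp add: \<iota>_def \<pi> \<psi>0)
    show "snd (\<kappa> y) = y" for y by (simp add: \<kappa>)
    show "\<iota> (\<pi> u) \<oplus>\<^bsub>P\<^esub> \<kappa> (snd u) = u" if "u \<in> carrier P" for u
      using that by (auto simp: P_def \<iota>_def \<kappa> \<pi> \<psi> A.a_assoc A.r_neg)
  qed
qed

theorem theorem5p4:
  fixes A :: "'a normed_space" and B :: "'b normed_space"
    and l :: "'b \<Rightarrow> 'a \<Rightarrow> 'a" and r :: "'a \<Rightarrow> 'b \<Rightarrow> 'a"
    and n :: nat
    and S :: "nat \<Rightarrow> ('a, 'u) bimodule" and T :: "nat \<Rightarrow> ('b, 'v) bimodule"
    and U :: "nat \<Rightarrow> ('a \<times> 'b, 'w) bimodule"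
  assumes "banach_algebra A" and "banach_algebra B"
    and "banach_bimodule B (with_actions A l r)"
    and "compatible_actions A B l r"
    and "unital A"
    and "dual_tower A n S" and "dual_tower B n T"
    and "dual_tower (amalgamated_duplication A B l r) n U"
  shows "n_weakly_amenable n (amalgamated_duplication A B l r) U \<longleftrightarrow>
    n_weakly_amenable n A S \<and> n_weakly_amenable n B T"
proof -
  obtain e where e: "e \<in> carrier A" "\<And>a. a \<in> carrier A \<Longrightarrow> e \<otimes>\<^bsub>A\<^esub> a = a"
    "\<And>a. a \<in> carrier A \<Longrightarrow> a \<otimes>\<^bsub>A\<^esub> e = a"
    using \<open>unital A\<close> unfolding unital_def by blast
  show ?thesis
    by (rule n_weakly_amenable_direct_sum[OF
        normed_bimodule_self_amalgamated_duplication[OF assms(1-4)]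
        normed_bimodule_self[OF assms(1)] normed_bimodule_self[OF assms(2)] assms(5)
        amalgamated_duplication_decomposition[OF assms(1-4) e] assms(6-8)])
qed

end
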